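(* Let $\vec v\in\mathbb R^3$ be a unit vector and let $\lambda\in\mathbb R$. There are no closed (compact without boundary) $\lambda$-translating solitons with density vector $\vec v$ in $\mathbb R^3$; that is, there is no immersion $\psi:\Sigma\to\mathbb R^3$ of a closed oriented surface $\Sigma$ with Gauss map $N$ whose mean curvature $H$ satisfies $H(p)=\lambda+\frac{\langle N(p),\vec v\rangle}{2}$ for all $p\in\Sigma$.
   Context: All surfaces are smooth, connected and oriented, and are immersed in Euclidean space $\mathbb R^3$ by an immersion $\psi$. The mean curvature $H$ is the average of the two principal curvatures with respect to the Gauss map (unit normal field) $N$, with sign convention $\Delta\psi=2HN$, where $\Delta$ is the Laplace-Beltrami operator of $\Sigma$. Given a unit vector $\vec v$ (the density vector) and $\lambda\in\mathbb R$, a $\lambda$-translating soliton is such a surface with $H=\lambda+\langle N,\vec v\rangle/2$ everywhere on it. *)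

theory Defs
  imports "HOL-Analysis.Analysis"
begin

section \<open>Smooth maps between normed spaces\<close>

text \<open>On an open subset of a Euclidean space, being of class \<open>C\<^sup>k\<^sup>+\<^sup>1\<close> is the same as being
  differentiable with all directional derivatives of class \<open>C\<^sup>k\<close>.  The predicates are only used
  for open domains.\<close>

primrec Ck_on ::
    "nat \<Rightarrow> 'a::real_normed_vector set \<Rightarrow> ('a \<Rightarrow> 'b::real_normed_vector) \<Rightarrow> bool" where
  "Ck_on 0 U f \<longleftrightarrow> continuous_on U f"
| "Ck_on (Suc k) U f \<longleftrightarrow>
     (\<forall>x\<in>U. f differentiable (at x)) \<and>
     (\<forall>w. Ck_on k U (\<lambda>x. frechet_derivative f (at x) w))"

definition smooth_on ::
    "'a::real_normed_vector set \<Rightarrow> ('a \<Rightarrow> 'b::real_normed_vector) \<Rightarrow> bool" where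
  "smooth_on U f \<longleftrightarrow> (\<forall>k. Ck_on k U f)"

section \<open>Oriented smooth surfaces\<close>

text \<open>A local parametrization is a pair \<open>(U, \<phi>)\<close> of an open set \<open>U\<close> of the plane and a
  homeomorphism \<open>\<phi>\<close> of \<open>U\<close> onto an open subset of the surface, that is, the inverse of a chart.
  The values of \<open>\<phi>\<close> outside \<open>U\<close> are irrelevant.\<close>

type_synonym 'a param = "(real^2) set \<times> (real^2 \<Rightarrow> 'a)"

definition local_param :: "'a topology \<Rightarrow> 'a param \<Rightarrow> bool" where
  "local_param X = (\<lambda>(U, \<phi>). open U \<and> openin X (\<phi> ` U) \<and>
     homeomorphic_map (top_of_set U) (subtopology X (\<phi> ` U)) \<phi>)"

definition overlap :: "'a param \<Rightarrow> 'a param \<Rightarrow> (real^2) set" where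
  "overlap c d = {u \<in> fst c. snd c u \<in> snd d ` fst d}"

definition transition :: "'a param \<Rightarrow> 'a param \<Rightarrow> real^2 \<Rightarrow> real^2" where
  "transition c d = (\<lambda>u. inv_into (fst d) (snd d) (snd c u))"

text \<open>The atlas \<open>A\<close> need not be maximal.  As parameter domains are open subsets of the whole
  plane, a surface has no boundary.\<close>

definition oriented_surface :: "'a topology \<Rightarrow> 'a param set \<Rightarrow> bool" where
  "oriented_surface X A \<longleftrightarrow>
     Hausdorff_space X \<and> second_countable X \<and> connected_space X \<and> topspace X \<noteq> {} \<and>
     (\<forall>c\<in>A. local_param X c) \<and>
     (\<Union>(U, \<phi>)\<in>A. \<phi> ` U) = topspace X \<and>
     (\<forall>c\<in>A. \<forall>d\<in>A. smooth_on (overlap c d) (transition c d) \<and>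
        (\<forall>u\<in>overlap c d. det (jacobian (transition c d) (at u)) > 0))"

definition closed_oriented_surface :: "'a topology \<Rightarrow> 'a param set \<Rightarrow> bool" where
  "closed_oriented_surface X A \<longleftrightarrow> oriented_surface X A \<and> compact_space X"

section \<open>Immersions, Gauss maps and mean curvature\<close>

definition smooth_map :: "'a param set \<Rightarrow> ('a \<Rightarrow> real^3) \<Rightarrow> bool" where
  "smooth_map A f \<longleftrightarrow> (\<forall>(U, \<phi>)\<in>A. smooth_on U (f \<circ> \<phi>))"

definition immersion :: "'a param set \<Rightarrow> ('a \<Rightarrow> real^3) \<Rightarrow> bool" where
  "immersion A \<psi> \<longleftrightarrow> smooth_map A \<psi> \<and>
     (\<forall>(U, \<phi>)\<in>A. \<forall>u\<in>U. inj (frechet_derivative (\<psi> \<circ> \<phi>) (at u)))"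

text \<open>A Gauss map is any smooth unit normal field.  It is not required to be the one induced by
  the orientation of the atlas, so both choices are covered.\<close>

definition gauss_map :: "'a param set \<Rightarrow> ('a \<Rightarrow> real^3) \<Rightarrow> ('a \<Rightarrow> real^3) \<Rightarrow> bool" where
  "gauss_map A \<psi> N \<longleftrightarrow> smooth_map A N \<and>
     (\<forall>(U, \<phi>)\<in>A. \<forall>u\<in>U. norm (N (\<phi> u)) = 1 \<and>
        (\<forall>w. N (\<phi> u) \<bullet> frechet_derivative (\<psi> \<circ> \<phi>) (at u) w = 0))"

text \<open>The principal curvatures \<open>\<kappa>\<^sub>1\<close>, \<open>\<kappa>\<^sub>2\<close> at \<open>p\<close> are the eigenvalues, with multiplicity, of the
  shape operator \<open>S\<close> determined by \<open>d\<psi> \<circ> S = - dN\<close>.  In a local parametrization, the vectors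
  \<open>a\<close>, \<open>b\<close> below represent a basis of the tangent plane consisting of eigenvectors; it exists
  because \<open>S\<close> is self-adjoint.  The sign is the one for which \<open>\<Delta>\<psi> = 2HN\<close>: the unit sphere with
  inward normal \<open>N = - \<psi>\<close> has \<open>\<kappa>\<^sub>1 = \<kappa>\<^sub>2 = 1\<close> and \<open>\<Delta>\<psi> = - 2 \<psi> = 2 N\<close>.\<close>

definition principal_curvatures ::
    "'a param set \<Rightarrow> ('a \<Rightarrow> real^3) \<Rightarrow> ('a \<Rightarrow> real^3) \<Rightarrow> 'a \<Rightarrow> real \<Rightarrow> real \<Rightarrow> bool" where
  "principal_curvatures A \<psi> N p \<kappa>\<^sub>1 \<kappa>\<^sub>2 \<longleftrightarrow>
     (\<exists>(U, \<phi>)\<in>A. \<exists>u\<in>U. \<phi> u = p \<and>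
       (\<exists>a b. a \<noteq> b \<and> independent {a, b} \<and>
          - frechet_derivative (N \<circ> \<phi>) (at u) a = \<kappa>\<^sub>1 *\<^sub>R frechet_derivative (\<psi> \<circ> \<phi>) (at u) a \<and>
          - frechet_derivative (N \<circ> \<phi>) (at u) b = \<kappa>\<^sub>2 *\<^sub>R frechet_derivative (\<psi> \<circ> \<phi>) (at u) b))"

text \<open>For an immersion with Gauss map \<open>N\<close>, exactly one \<open>H\<close> satisfies this at each point of the
  surface, independently of the parametrization.\<close>

definition has_mean_curvature ::
    "'a param set \<Rightarrow> ('a \<Rightarrow> real^3) \<Rightarrow> ('a \<Rightarrow> real^3) \<Rightarrow> 'a \<Rightarrow> real \<Rightarrow> bool" where
  "has_mean_curvature A \<psi> N p H \<longleftrightarrow>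
     (\<exists>\<kappa>\<^sub>1 \<kappa>\<^sub>2. principal_curvatures A \<psi> N p \<kappa>\<^sub>1 \<kappa>\<^sub>2 \<and> H = (\<kappa>\<^sub>1 + \<kappa>\<^sub>2) / 2)"

definition translating_soliton ::
    "real \<Rightarrow> real^3 \<Rightarrow> 'a topology \<Rightarrow> 'a param set \<Rightarrow> ('a \<Rightarrow> real^3) \<Rightarrow> ('a \<Rightarrow> real^3) \<Rightarrow> bool" where
  "translating_soliton c v X A \<psi> N \<longleftrightarrow>
     oriented_surface X A \<and> immersion A \<psi> \<and> gauss_map A \<psi> N \<and>
     (\<forall>p\<in>topspace X. has_mean_curvature A \<psi> N p (c + (N p \<bullet> v) / 2))"

end

theory Submission
  imports Defs
begin

text \<open>With \<open>n = \<langle>N, v\<rangle>\<close>, the identity \<open>\<Delta>\<psi> = 2HN\<close> gives \<open>\<Delta>\<langle>\<psi>, v\<rangle> = 2\<lambda>n + n\<^sup>2\<close>, and \<open>n\<close> is itself a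
  divergence, because the flux of the constant field \<open>v\<close> through a closed surface vanishes. Both facts
  are contained in the equation \<open>d\<langle>W, d\<psi>\<rangle> = n\<^sup>2 dA\<close> for \<open>W = N \<times> v - \<lambda> (v \<times> \<psi>)\<close>. By Stokes' theorem
  \<open>n = 0\<close> everywhere, whereas \<open>n = \<plusminus>1\<close> at a highest point of the surface in the direction of \<open>v\<close>.\<close>

section \<open>Continuously differentiable maps\<close>

text \<open>Origin of \<open>W\<close>: where \<open>N\<close> agrees with the orientation, the
  one-form <N x v, d psi> is the Hodge star of d<psi, v>, so its exterior derivative is the
  Laplacian term 2 H n dA. Moreover d<v x psi, d psi> = 2 n dA, so \<open>v \<times> \<psi>\<close>
  is a potential for the flux. The coefficient -lambda is the one that cancels the linear part of 2
  H n = 2 lambda n + n^2. In this form the identity involves only first derivatives of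
  \<open>N\<close> and \<open>\<psi>\<close> in a chart; neither metric, Laplacian nor area measure
  has to be constructed. Two obstacles shape the rest. Stokes' theorem has to be assembled from
  integrals over plane domains. Since d<F, dG> takes one derivative of F and two of G, cutoffs are
  put on F and chosen merely C1, which keeps them elementary. And \<open>N\<close> is not tied to
  the orientation of the atlas, so n^2 dA is nonnegative only up to a sign; connectedness makes that
  sign the same everywhere.\<close>

abbreviation D :: "('a::real_normed_vector \<Rightarrow> 'b::real_normed_vector) \<Rightarrow> 'a \<Rightarrow> 'a \<Rightarrow> 'b" where
  "D f x \<equiv> frechet_derivative f (at x)"

lemma D_eq: "(f has_derivative f') (at x) \<Longrightarrow> D f x = f'"
  by (metis frechet_derivative_at)

text \<open>Continuity is stated for each fixed direction \<open>w\<close>; on Euclidean spaces this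
  amounts to continuity of the derivative as a map into linear maps.\<close>

definition C1_on :: "'a::real_normed_vector set \<Rightarrow> ('a \<Rightarrow> 'b::real_normed_vector) \<Rightarrow> bool" where
  "C1_on U f \<longleftrightarrow> (\<forall>x\<in>U. f differentiable (at x)) \<and> (\<forall>w. continuous_on U (\<lambda>x. D f x w))"

lemma C1_onI:
  assumes "\<And>x. x \<in> U \<Longrightarrow> (f has_derivative f' x) (at x)"
    and "\<And>w. continuous_on U (\<lambda>x. f' x w)"
  shows "C1_on U f"
proof -
  have "continuous_on U (\<lambda>x. D f x w)" for w
    using assms(2)[of w] by (rule continuous_on_eq) (metis assms(1) D_eq)
  then show ?thesis
    using assms(1) unfolding C1_on_def differentiable_def by blast
qed

lemma C1_on_D: "C1_on U f \<Longrightarrow> x \<in> U \<Longrightarrow> (f has_derivative D f x) (at x)"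
  unfolding C1_on_def using frechet_derivative_works by blast

lemma C1_on_cont_D: "C1_on U f \<Longrightarrow> continuous_on U (\<lambda>x. D f x w)"
  unfolding C1_on_def by simp

lemma C1_on_continuous: "C1_on U f \<Longrightarrow> continuous_on U f"
  unfolding C1_on_def
  by (meson continuous_at_imp_continuous_on differentiable_imp_continuous_within)

lemma smooth_on_C1: "smooth_on U f \<Longrightarrow> C1_on U f"
  unfolding smooth_on_def C1_on_def by (metis Ck_on.simps)

lemma smooth_on_C1_D:
  assumes "smooth_on U f" shows "C1_on U (\<lambda>x. D f x w)"
proof -
  have "Ck_on (Suc (Suc 0)) U f" using assms smooth_on_def by blast
  then show ?thesis unfolding C1_on_def by simp
qed

lemma C1_on_const: "C1_on U (\<lambda>x. k)"
  by (rule C1_onI[where f'="\<lambda>x h. 0"]) auto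

lemma C1_on_bilinear:
  assumes "bounded_bilinear b" "C1_on U f" "C1_on U g"
  shows "C1_on U (\<lambda>x. b (f x) (g x))"
proof (rule C1_onI)
  interpret bounded_bilinear b by fact
  show "((\<lambda>x. b (f x) (g x)) has_derivative (\<lambda>h. b (f x) (D g x h) + b (D f x h) (g x))) (at x)"
    if "x \<in> U" for x
    by (intro FDERIV C1_on_D[OF assms(2)] C1_on_D[OF assms(3)] that)
  show "continuous_on U (\<lambda>x. b (f x) (D g x w) + b (D f x w) (g x))" for w
    by (intro continuous_on_add continuous_on C1_on_continuous[OF assms(2)]
        C1_on_continuous[OF assms(3)] C1_on_cont_D assms)
qed

lemma C1_on_bounded_linear:
  assumes "bounded_linear L" "C1_on U f"
  shows "C1_on U (\<lambda>x. L (f x))"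
proof (rule C1_onI)
  show "((\<lambda>x. L (f x)) has_derivative (\<lambda>h. L (D f x h))) (at x)" if "x \<in> U" for x
    using bounded_linear.has_derivative[OF assms(1) C1_on_D[OF assms(2) that]] .
  show "continuous_on U (\<lambda>x. L (D f x w))" for w
    by (intro bounded_linear.continuous_on[OF assms(1)] C1_on_cont_D assms)
qed

lemma C1_on_add:
  assumes "C1_on U f" "C1_on U g" shows "C1_on U (\<lambda>x. f x + g x)"
proof (rule C1_onI)
  show "((\<lambda>x. f x + g x) has_derivative (\<lambda>h. D f x h + D g x h)) (at x)" if "x \<in> U" for x
    by (intro has_derivative_add C1_on_D[OF assms(1)] C1_on_D[OF assms(2)] that)
qed (intro continuous_on_add C1_on_cont_D assms)

lemma C1_on_sum:
  assumes "\<And>i. i \<in> I \<Longrightarrow> C1_on U (f i)" shows "C1_on U (\<lambda>x. \<Sum>i\<in>I. f i x)"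
  using assms by (induction I rule: infinite_finite_induct) (auto intro: C1_on_add C1_on_const)

lemma C1_on_inverse:
  fixes f :: "'a::real_normed_vector \<Rightarrow> real"
  assumes "C1_on U f" "\<And>x. x \<in> U \<Longrightarrow> f x \<noteq> 0" shows "C1_on U (\<lambda>x. inverse (f x))"
proof (rule C1_onI)
  show "((\<lambda>x. inverse (f x)) has_derivative (\<lambda>h. - (inverse (f x) * D f x h * inverse (f x)))) (at x)"
    if "x \<in> U" for x
    using Deriv.has_derivative_inverse[OF assms(2)[OF that] C1_on_D[OF assms(1) that]] by simp
  show "continuous_on U (\<lambda>x. - (inverse (f x) * D f x w * inverse (f x)))" for w
    by (intro continuous_intros C1_on_cont_D C1_on_continuous assms ballI)
qed

lemma C1_on_compose:
  fixes f :: "'a::euclidean_space \<Rightarrow> 'b::euclidean_space" and g :: "'b \<Rightarrow> 'c::real_normed_vector"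
  assumes "C1_on U f" "C1_on V g" "f ` U \<subseteq> V"
  shows "C1_on U (\<lambda>x. g (f x))"
proof (rule C1_onI)
  show "((\<lambda>x. g (f x)) has_derivative (\<lambda>h. D g (f x) (D f x h))) (at x)" if "x \<in> U" for x
    using diff_chain_at[OF C1_on_D[OF assms(1) that], of g "D g (f x)"] C1_on_D[OF assms(2), of "f x"]
      assms(3) that by (auto simp: o_def)
  show "continuous_on U (\<lambda>x. D g (f x) (D f x w))" for w
  proof -
    \<comment> \<open>\<open>C1_on\<close> controls \<open>D g y\<close> in fixed directions,
      whereas the direction \<open>D f x w\<close> varies with \<open>x\<close>. Expanding it in the
      basis reduces to fixed directions.\<close>
    have lin: "D g y (\<Sum>b\<in>Basis. (z \<bullet> b) *\<^sub>R b) = (\<Sum>b\<in>Basis. (z \<bullet> b) *\<^sub>R D g y b)" if "y \<in> V" for y z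
    proof -
      have "linear (D g y)" using C1_on_D[OF assms(2) that] has_derivative_linear by blast
      then show ?thesis by (simp add: linear_sum linear_cmul)
    qed
    have "continuous_on U (\<lambda>x. \<Sum>b\<in>Basis. (D f x w \<bullet> b) *\<^sub>R D g (f x) b)"
      by (intro continuous_intros C1_on_cont_D assms(1)
          continuous_on_compose2[OF C1_on_cont_D[OF assms(2)] C1_on_continuous[OF assms(1)] assms(3)])
    then show ?thesis
    proof (rule continuous_on_eq)
      fix x assume "x \<in> U"
      then have "f x \<in> V" using assms(3) by blast
      then show "(\<Sum>b\<in>Basis. (D f x w \<bullet> b) *\<^sub>R D g (f x) b) = D g (f x) (D f x w)"
        using lin[of "f x" "D f x w"] by (simp add: euclidean_representation)
    qed
  qed
qed

lemma D_cong_open: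
  assumes "open V" "x \<in> V" "\<And>y. y \<in> V \<Longrightarrow> f y = g y"
  shows "D f x = D g x"
proof -
  have "(f has_derivative f') (at x) \<longleftrightarrow> (g has_derivative f') (at x)" for f'
    using has_derivative_transform_within_open[OF _ assms(1,2)] assms(3) by metis
  then show ?thesis unfolding frechet_derivative_def by simp
qed

lemma C1_on_cong_open:
  assumes "C1_on V f" "open V" "\<And>y. y \<in> V \<Longrightarrow> f y = g y"
  shows "C1_on V g"
proof (rule C1_onI)
  show "(g has_derivative D f x) (at x)" if "x \<in> V" for x
    using has_derivative_transform_within_open[OF C1_on_D[OF assms(1) that] assms(2) that assms(3)] .
qed (intro C1_on_cont_D assms)

lemma C1_on_Un_open:
  assumes "open U" "open V" "C1_on U f" "C1_on V f" shows "C1_on (U \<union> V) f"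
  using assms unfolding C1_on_def by (auto intro: continuous_on_open_Un)

text \<open>The open sets \<open>U\<close> and \<open>-K\<close> cover the space, and on
  \<open>-K\<close> the extension is identically 0.\<close>

lemma C1_on_zero_extension:
  assumes "open U" "closed K" "C1_on U f" "\<And>x. x \<in> U \<Longrightarrow> x \<notin> K \<Longrightarrow> f x = 0" "K \<subseteq> U"
  shows "C1_on UNIV (\<lambda>x. if x \<in> U then f x else 0)" (is "C1_on _ ?g")
proof -
  have "C1_on U ?g" by (rule C1_on_cong_open[OF assms(3,1)]) auto
  moreover have "C1_on (-K) ?g"
    by (rule C1_on_cong_open[OF C1_on_const[of "-K" 0]]) (use assms in auto)
  moreover have "U \<union> -K = UNIV" using assms by auto
  ultimately show ?thesis using C1_on_Un_open[of U "-K" ?g] assms by auto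
qed

section \<open>Integrals of derivatives of compactly supported functions\<close>

lemma has_real_derivative_along_line:
  fixes f :: "'a::real_normed_vector \<Rightarrow> real"
  assumes "(f has_derivative f') (at (x + t *\<^sub>R e))"
  shows "((\<lambda>t. f (x + t *\<^sub>R e)) has_real_derivative f' e) (at t)"
proof -
  have "((\<lambda>t. x + t *\<^sub>R e) has_derivative (\<lambda>h. h *\<^sub>R e)) (at t)"
    by (auto intro!: derivative_eq_intros)
  from diff_chain_at[OF this assms]
  have "((\<lambda>t. f (x + t *\<^sub>R e)) has_derivative (\<lambda>h. f' (h *\<^sub>R e))) (at t)"
    by (simp add: o_def)
  moreover have "(\<lambda>h. f' (h *\<^sub>R e)) = (*) (f' e)"
    using assms by (auto simp: linear_cmul has_derivative_linear mult.commute)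
  ultimately show ?thesis by (simp add: has_field_derivative_def)
qed

text \<open>The difference quotients along \<open>e\<close> have integral 0 because Lebesgue measure
  is translation invariant; dominated convergence carries this over to the derivative.\<close>

lemma integral_directional_derivative_0:
  fixes f :: "'a::euclidean_space \<Rightarrow> real"
  assumes f: "C1_on UNIV f" and K: "compact K" and 0: "\<And>x. x \<notin> K \<Longrightarrow> f x = 0"
  shows "((\<lambda>x. D f x e) has_integral 0) UNIV"
proof -
  have cf: "continuous_on UNIV f" by (rule C1_on_continuous[OF f])
  have cD: "continuous_on UNIV (\<lambda>x. D f x e)" by (rule C1_on_cont_D[OF f])
  have D0: "D f x e = 0" if "x \<notin> K" for x
  proof -
    have "D f x = D (\<lambda>x. 0) x"
      by (rule D_cong_open[of "-K"]) (use that K 0 in \<open>auto simp: compact_imp_closed open_Compl\<close>)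
    then show ?thesis by simp
  qed
  have "bounded ((\<lambda>x. D f x e) ` K)"
    by (intro compact_imp_bounded compact_continuous_image K continuous_on_subset[OF cD]) auto
  then obtain B0 where B0: "\<And>x. x \<in> K \<Longrightarrow> \<bar>D f x e\<bar> \<le> B0" by (auto simp: bounded_iff)
  define B where "B = max 0 B0"
  have B: "\<bar>D f x e\<bar> \<le> B" for x using B0[of x] D0[of x] by (cases "x \<in> K") (auto simp: B_def)
  obtain r where "\<forall>x\<in>K. norm x \<le> r"
    using compact_imp_bounded[OF K] bounded_iff by metis
  then have r: "K \<subseteq> cball 0 r" by auto
  \<comment> \<open>The step sizes \<open>s n\<close> are at most 1, so all quotients
    \<open>F n\<close> vanish outside one ball of radius \<open>R\<close>. With the mean value bound
    \<open>B\<close> this gives the integrable majorant.\<close>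
  define R where "R = r + norm e"
  define s where "s n = inverse (real (Suc n))" for n
  have s: "0 < s n" "s n \<le> 1" for n unfolding s_def by (auto simp: field_simps)
  define F where "F n x = (f (x + s n *\<^sub>R e) - f x) / s n" for n x
  have int_f: "integrable lborel f"
  proof -
    have "integrable lborel (\<lambda>x. indicator K x *\<^sub>R f x)"
      by (rule borel_integrable_compact[OF K continuous_on_subset[OF cf]]) auto
    moreover have "(\<lambda>x. indicator K x *\<^sub>R f x) = f" using 0 by (auto simp: indicator_def fun_eq_iff)
    ultimately show ?thesis by simp
  qed
  have shift: "integrable lborel (\<lambda>x. f (x + c))" "(\<integral>x. f (x + c) \<partial>lborel) = (\<integral>x. f x \<partial>lborel)" for c
  proof -
    have m: "f \<in> borel_measurable borel" using cf borel_measurable_continuous_onI by blast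
    have "integrable (distr lborel borel ((+) c)) f" using int_f by (simp add: lborel_distr_plus)
    then show "integrable lborel (\<lambda>x. f (x + c))"
      using integrable_distr_eq[of "(+) c" lborel borel f] m by (simp add: add.commute)
    have "(\<integral>x. f x \<partial>lborel) = (\<integral>x. f x \<partial>(distr lborel borel ((+) c)))" by (simp add: lborel_distr_plus)
    also have "\<dots> = (\<integral>x. f (c + x) \<partial>lborel)" using m by (intro integral_distr) auto
    finally show "(\<integral>x. f (x + c) \<partial>lborel) = (\<integral>x. f x \<partial>lborel)" by (simp add: add.commute)
  qed
  have F0: "(\<integral>x. F n x \<partial>lborel) = 0" for n
    unfolding F_def using shift int_f by (simp add: Bochner_Integration.integral_diff)
  have meas: "F n \<in> borel_measurable lborel" for n
  proof -
    have "integrable lborel (F n)"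
      unfolding F_def using shift int_f by (intro integrable_divide Bochner_Integration.integrable_diff)
    then show ?thesis by simp
  qed
  have mvt: "\<exists>z. F n x = D f z e" for n x
  proof -
    have d: "((\<lambda>t. f (x + t *\<^sub>R e)) has_real_derivative D f (x + t *\<^sub>R e) e) (at t)" for t
      by (rule has_real_derivative_along_line[OF C1_on_D[OF f UNIV_I]])
    obtain z where "f (x + s n *\<^sub>R e) - f (x + 0 *\<^sub>R e) = (s n - 0) * D f (x + z *\<^sub>R e) e"
      using MVT2[of 0 "s n" "\<lambda>t. f (x + t *\<^sub>R e)" "\<lambda>t. D f (x + t *\<^sub>R e) e"] d s(1)[of n] by blast
    then have "F n x = D f (x + z *\<^sub>R e) e" unfolding F_def using s(1)[of n] by simp
    then show ?thesis by blast
  qed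
  have Fout: "F n x = 0" if "x \<notin> cball 0 R" for n x
  proof -
    have "norm x > r + norm e" using that by (simp add: R_def)
    moreover have "norm (s n *\<^sub>R e) \<le> norm e"
      using s[of n] by (simp add: mult_left_le_one_le)
    moreover have "norm x \<le> norm (x + s n *\<^sub>R e) + norm (s n *\<^sub>R e)"
      using norm_triangle_ineq4[of "x + s n *\<^sub>R e" "s n *\<^sub>R e"] by simp
    ultimately have "norm (x + s n *\<^sub>R e) > r" "norm x > r" using norm_ge_zero[of e] by linarith+
    then have "x + s n *\<^sub>R e \<notin> K" "x \<notin> K" using r by auto
    then show ?thesis using 0 by (simp add: F_def)
  qed
  have lim: "(\<lambda>n. F n x) \<longlonglongrightarrow> D f x e" for x
  proof -
    have "((\<lambda>t. f (x + t *\<^sub>R e)) has_real_derivative D f x e) (at 0)"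
      using has_real_derivative_along_line[of f "D f x" x 0 e] C1_on_D[OF f UNIV_I] by simp
    then have "((\<lambda>h. (f (x + h *\<^sub>R e) - f x) / h) \<longlongrightarrow> D f x e) (at 0)"
      by (simp add: has_field_derivative_iff)
    moreover have "filterlim s (at 0) sequentially"
      unfolding filterlim_at using s(1) LIMSEQ_inverse_real_of_nat
      by (auto simp: s_def[abs_def] intro!: always_eventually less_imp_neq)
    ultimately show ?thesis unfolding F_def by (rule filterlim_compose)
  qed
  have bint: "integrable lborel (\<lambda>x. indicator (cball 0 R) x *\<^sub>R B :: real)"
    by (rule borel_integrable_compact) auto
  have bound: "norm (F n x) \<le> indicator (cball 0 R) x *\<^sub>R B" for n x
    using mvt[of n x] B Fout[of x n] by (auto simp: indicator_def)
  have mD: "(\<lambda>x. D f x e) \<in> borel_measurable lborel"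
    using cD borel_measurable_continuous_onI by auto
  have "integrable lborel (\<lambda>x. D f x e)"
    by (rule integrable_dominated_convergence[where s=F, OF mD meas bint]) (intro AE_I2 lim bound)+
  moreover have "(\<lambda>n. \<integral>x. F n x \<partial>lborel) \<longlonglongrightarrow> (\<integral>x. D f x e \<partial>lborel)"
    by (rule integral_dominated_convergence[where s=F, OF mD meas bint]) (intro AE_I2 lim bound)+
  then have "(\<integral>x. D f x e \<partial>lborel) = 0" using F0 by (simp add: LIMSEQ_const_iff)
  ultimately show ?thesis using has_integral_integral_lborel by metis
qed

section \<open>Exact two-forms in plane domains\<close>

text \<open>The mean value theorem is used twice: along \<open>w\<close> for the difference of
  \<open>g\<close> across the side \<open>t *\<^sub>R u\<close>, then along \<open>u\<close> for the
  derivative in direction \<open>w\<close>.\<close>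

lemma second_difference_mvt:
  fixes g :: "'a::real_normed_vector \<Rightarrow> real"
  assumes t: "0 < t"
    and in_U: "\<And>a b. 0 \<le> a \<Longrightarrow> a \<le> t \<Longrightarrow> 0 \<le> b \<Longrightarrow> b \<le> t \<Longrightarrow> x + a *\<^sub>R u + b *\<^sub>R w \<in> U"
    and g: "C1_on U g" and gw: "C1_on U (\<lambda>y. D g y w)"
  obtains a b where "0 < a" "a < t" "0 < b" "b < t"
    "g (x + t *\<^sub>R u + t *\<^sub>R w) - g (x + t *\<^sub>R u) - g (x + t *\<^sub>R w) + g x
      = t\<^sup>2 * D (\<lambda>y. D g y w) (x + a *\<^sub>R u + b *\<^sub>R w) u"
proof -
  have d1: "((\<lambda>s. g (x + t *\<^sub>R u + s *\<^sub>R w) - g (x + s *\<^sub>R w)) has_real_derivative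
      D g (x + t *\<^sub>R u + s *\<^sub>R w) w - D g (x + s *\<^sub>R w) w) (at s)" if "0 \<le> s" "s \<le> t" for s
    using in_U[of t s] in_U[of 0 s] that t
    by (intro DERIV_diff has_real_derivative_along_line C1_on_D[OF g]) auto
  obtain b where b: "0 < b" "b < t" and
    eb: "(g (x + t *\<^sub>R u + t *\<^sub>R w) - g (x + t *\<^sub>R w)) - (g (x + t *\<^sub>R u + 0 *\<^sub>R w) - g (x + 0 *\<^sub>R w))
      = (t - 0) * (D g (x + t *\<^sub>R u + b *\<^sub>R w) w - D g (x + b *\<^sub>R w) w)"
    using MVT2[OF t d1] by blast
  have d2: "((\<lambda>s. D g ((x + b *\<^sub>R w) + s *\<^sub>R u) w) has_real_derivative
      D (\<lambda>y. D g y w) ((x + b *\<^sub>R w) + s *\<^sub>R u) u) (at s)" if "0 \<le> s" "s \<le> t" for s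
    using in_U[of s b] that b
    by (intro has_real_derivative_along_line C1_on_D[OF gw]) (simp add: ac_simps)
  obtain a where a: "0 < a" "a < t" and
    ea: "D g ((x + b *\<^sub>R w) + t *\<^sub>R u) w - D g ((x + b *\<^sub>R w) + 0 *\<^sub>R u) w
      = (t - 0) * D (\<lambda>y. D g y w) ((x + b *\<^sub>R w) + a *\<^sub>R u) u"
    using MVT2[OF t d2] by blast
  show thesis
    by (rule that[OF a b]) (use ea eb in \<open>simp add: ac_simps power2_eq_square\<close>)
qed

text \<open>The second difference over a parallelogram does not change when \<open>u\<close> and
  \<open>w\<close> are exchanged. Hence the two mixed derivatives share a value at some points
  (possibly different ones) arbitrarily close to \<open>x\<close>, and continuity at
  \<open>x\<close> concludes.\<close>

lemma mixed_derivatives_real: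
  fixes g :: "'a::real_normed_vector \<Rightarrow> real"
  assumes U: "open U" "x \<in> U" and g: "C1_on U g"
    and gu: "C1_on U (\<lambda>y. D g y u)" and gw: "C1_on U (\<lambda>y. D g y w)"
  shows "D (\<lambda>y. D g y w) x u = D (\<lambda>y. D g y u) x w"
proof -
  define P where "P y = D (\<lambda>y. D g y w) y u" for y
  define Q where "Q y = D (\<lambda>y. D g y u) y w" for y
  have "continuous (at x) P" "continuous (at x) Q"
    using C1_on_cont_D[OF gw, of u] C1_on_cont_D[OF gu, of w] U
    unfolding P_def[abs_def] Q_def[abs_def] by (auto simp: continuous_on_eq_continuous_at)
  have "\<bar>P x - Q x\<bar> < e" if e: "e > 0" for e
  proof -
    obtain d1 where d1: "d1 > 0" "\<And>y. dist y x < d1 \<Longrightarrow> dist (P y) (P x) < e / 2"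
      using \<open>continuous (at x) P\<close> half_gt_zero[OF e] unfolding continuous_at_eps_delta by blast
    obtain d2 where d2: "d2 > 0" "\<And>y. dist y x < d2 \<Longrightarrow> dist (Q y) (Q x) < e / 2"
      using \<open>continuous (at x) Q\<close> half_gt_zero[OF e] unfolding continuous_at_eps_delta by blast
    obtain d3 where d3: "d3 > 0" "ball x d3 \<subseteq> U" using U openE by blast
    define d where "d = min d1 (min d2 d3)"
    \<comment> \<open>Keeps the whole parallelogram within \<open>d / 2\<close> of \<open>x\<close>;
      the summand 1 keeps the denominator positive when \<open>u\<close> and \<open>w\<close> are
      both 0.\<close>
    define t where "t = d / (2 * (norm u + norm w + 1))"
    have "d > 0" using d1 d2 d3 by (simp add: d_def)
    have den: "norm u + norm w + 1 > 0" using norm_ge_zero[of u] norm_ge_zero[of w] by linarith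
    have t: "t > 0" using \<open>d > 0\<close> den by (simp add: t_def)
    have near: "dist (x + a *\<^sub>R u + b *\<^sub>R w) x < d" if "0 \<le> a" "a \<le> t" "0 \<le> b" "b \<le> t" for a b
    proof -
      have "dist (x + a *\<^sub>R u + b *\<^sub>R w) x = norm (a *\<^sub>R u + b *\<^sub>R w)" by (simp add: dist_norm add.assoc)
      also have "\<dots> \<le> a * norm u + b * norm w" using norm_triangle_ineq[of "a *\<^sub>R u" "b *\<^sub>R w"] that by simp
      also have "\<dots> \<le> t * norm u + t * norm w" using that by (intro add_mono mult_right_mono) auto
      also have "\<dots> \<le> t * (norm u + norm w + 1)" using t by (simp add: algebra_simps)
      also have "\<dots> = d / 2" using den by (simp add: t_def field_simps)
      also have "\<dots> < d" using \<open>d > 0\<close> by simp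
      finally show ?thesis .
    qed
    have in_U: "x + a *\<^sub>R u + b *\<^sub>R w \<in> U" if "0 \<le> a" "a \<le> t" "0 \<le> b" "b \<le> t" for a b
      using near[OF that] d3(2) by (auto simp: d_def dist_commute mem_ball subset_iff)
    have in_U': "x + a *\<^sub>R w + b *\<^sub>R u \<in> U" if "0 \<le> a" "a \<le> t" "0 \<le> b" "b \<le> t" for a b
      using in_U[of b a] that by (simp add: ac_simps)
    obtain a b where ab: "0 < a" "a < t" "0 < b" "b < t"
      and e1: "g (x + t *\<^sub>R u + t *\<^sub>R w) - g (x + t *\<^sub>R u) - g (x + t *\<^sub>R w) + g x
        = t\<^sup>2 * P (x + a *\<^sub>R u + b *\<^sub>R w)"
      unfolding P_def by (rule second_difference_mvt[OF t in_U g gw]) blast+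
    obtain a' b' where ab': "0 < a'" "a' < t" "0 < b'" "b' < t"
      and e2: "g (x + t *\<^sub>R w + t *\<^sub>R u) - g (x + t *\<^sub>R w) - g (x + t *\<^sub>R u) + g x
        = t\<^sup>2 * Q (x + a' *\<^sub>R w + b' *\<^sub>R u)"
      unfolding Q_def by (rule second_difference_mvt[OF t in_U' g gu]) blast+
    have "t\<^sup>2 * P (x + a *\<^sub>R u + b *\<^sub>R w) = t\<^sup>2 * Q (x + b' *\<^sub>R u + a' *\<^sub>R w)"
    proof -
      have eqs: "x + t *\<^sub>R w + t *\<^sub>R u = x + t *\<^sub>R u + t *\<^sub>R w"
        "x + a' *\<^sub>R w + b' *\<^sub>R u = x + b' *\<^sub>R u + a' *\<^sub>R w"
        by (simp_all only: add.assoc add.commute add.left_commute)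
      show ?thesis using e1 e2[unfolded eqs] by linarith
    qed
    then have "P (x + a *\<^sub>R u + b *\<^sub>R w) = Q (x + b' *\<^sub>R u + a' *\<^sub>R w)" using t by simp
    moreover have "dist (P (x + a *\<^sub>R u + b *\<^sub>R w)) (P x) < e / 2"
      using near[of a b] ab by (intro d1(2)) (simp add: d_def)
    moreover have "dist (Q (x + b' *\<^sub>R u + a' *\<^sub>R w)) (Q x) < e / 2"
      using near[of b' a'] ab' by (intro d2(2)) (simp add: d_def)
    ultimately show ?thesis unfolding dist_real_def by linarith
  qed
  then have "P x = Q x" by (metis less_irrefl right_minus_eq zero_less_abs_iff)
  then show ?thesis by (simp add: P_def Q_def)
qed

lemma mixed_derivatives:
  fixes G :: "'a::real_normed_vector \<Rightarrow> 'b::euclidean_space"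
  assumes U: "open U" "x \<in> U" and G: "C1_on U G" and GD: "\<And>w. C1_on U (\<lambda>y. D G y w)"
  shows "D (\<lambda>y. D G y w) x u = D (\<lambda>y. D G y u) x w"
proof (rule euclidean_eqI)
  fix b :: 'b assume "b \<in> Basis"
  have inner_D: "D (\<lambda>y. f y \<bullet> b) y h = D f y h \<bullet> b" if "C1_on U f" "y \<in> U" for f :: "'a \<Rightarrow> 'b" and y h
    using D_eq[OF bounded_linear.has_derivative[OF bounded_linear_inner_left C1_on_D[OF that]]] by metis
  have G': "C1_on U (\<lambda>y. G y \<bullet> b)"
    by (rule C1_on_bounded_linear[OF bounded_linear_inner_left G])
  have GD': "C1_on U (\<lambda>y. D (\<lambda>y. G y \<bullet> b) y w)" for w
    by (rule C1_on_cong_open[OF C1_on_bounded_linear[OF bounded_linear_inner_left GD] U(1)])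
      (simp add: inner_D[OF G])
  have "D (\<lambda>y. D (\<lambda>y. G y \<bullet> b) y w) x u = D (\<lambda>y. D G y w) x u \<bullet> b" for w u
    using D_cong_open[OF U, of "\<lambda>y. D (\<lambda>y. G y \<bullet> b) y w" "\<lambda>y. D G y w \<bullet> b"]
    by (simp add: inner_D[OF G] inner_D[OF GD U(2)])
  then show "D (\<lambda>y. D G y w) x u \<bullet> b = D (\<lambda>y. D G y u) x w \<bullet> b"
    using mixed_derivatives_real[OF U G' GD' GD'] by metis
qed

text \<open>The coefficient of \<open>du\<^sub>1 \<and> du\<^sub>2\<close> in \<open>\<langle>dF \<and> dG\<rangle> = d\<langle>F, dG\<rangle>\<close>.\<close>

definition wedge :: "(real^2 \<Rightarrow> 'b::real_inner) \<Rightarrow> (real^2 \<Rightarrow> 'b) \<Rightarrow> real^2 \<Rightarrow> real" where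
  "wedge F G x = D F x (axis 1 1) \<bullet> D G x (axis 2 1) - D F x (axis 2 1) \<bullet> D G x (axis 1 1)"

lemma wedge_continuous:
  "C1_on U F \<Longrightarrow> C1_on U G \<Longrightarrow> continuous_on U (wedge F G)"
  unfolding wedge_def[abs_def] by (intro continuous_intros C1_on_cont_D)

lemma wedge_cong_open:
  "open V \<Longrightarrow> x \<in> V \<Longrightarrow> (\<And>y. y \<in> V \<Longrightarrow> F y = F' y) \<Longrightarrow> (\<And>y. y \<in> V \<Longrightarrow> G y = G' y)
    \<Longrightarrow> wedge F G x = wedge F' G' x"
  unfolding wedge_def using D_cong_open[of V x F F'] D_cong_open[of V x G G'] by simp

lemma wedge_0 [simp]: "wedge (\<lambda>x. 0) G x = 0"
  by (simp add: wedge_def)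

text \<open>Stokes' theorem in the plane for the one-form <F, dG> extended by 0. Differentiating its
  components produces \<open>wedge F G\<close> and terms with second derivatives of
  \<open>G\<close>; the latter cancel by symmetry.\<close>

lemma wedge_integral_0:
  fixes F G :: "real^2 \<Rightarrow> 'b::euclidean_space"
  assumes U: "open U" and K: "compact K" "K \<subseteq> U" and F: "C1_on U F"
    and F0: "\<And>x. x \<in> U \<Longrightarrow> x \<notin> K \<Longrightarrow> F x = 0"
    and G: "C1_on U G" and GD: "\<And>w. C1_on U (\<lambda>x. D G x w)"
  shows "(wedge F G has_integral 0) U"
proof -
  define f where "f w x = (if x \<in> U then F x \<bullet> D G x w else 0)" for w x
  have f_C1: "C1_on UNIV (f w)" for w
    unfolding f_def
    by (rule C1_on_zero_extension[OF U compact_imp_closed[OF K(1)] C1_on_bilinear[OF bounded_bilinear_inner F GD]])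
      (use F0 K in auto)
  have f0: "f w x = 0" if "x \<notin> K" for w x using F0 that by (simp add: f_def)
  have "((\<lambda>x. D (f (axis 2 1)) x (axis 1 1) - D (f (axis 1 1)) x (axis 2 1)) has_integral 0 - 0) UNIV"
    by (intro has_integral_diff integral_directional_derivative_0[OF f_C1 K(1)] f0)
  moreover have "D (f (axis 2 1)) x (axis 1 1) - D (f (axis 1 1)) x (axis 2 1)
      = (if x \<in> U then wedge F G x else 0)" for x
  proof (cases "x \<in> U")
    case True
    have "D (f w) x h = F x \<bullet> D (\<lambda>x. D G x w) x h + D F x h \<bullet> D G x w" for w h
    proof -
      have "D (f w) x = D (\<lambda>x. F x \<bullet> D G x w) x"
        by (rule D_cong_open[OF U True]) (simp add: f_def)
      also have "\<dots> = (\<lambda>h. F x \<bullet> D (\<lambda>x. D G x w) x h + D F x h \<bullet> D G x w)"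
        by (intro D_eq bounded_bilinear.FDERIV[OF bounded_bilinear_inner] C1_on_D[OF F True] C1_on_D[OF GD True])
      finally show ?thesis by simp
    qed
    then show ?thesis
      using mixed_derivatives[OF U True G GD, of "axis 1 1" "axis 2 1"] True by (simp add: wedge_def)
  next
    case False
    have "D (f w) x = D (\<lambda>x. 0) x" for w
      by (rule D_cong_open[of "-K"]) (use False K f0 in \<open>auto simp: compact_imp_closed open_Compl\<close>)
    then show ?thesis using False by simp
  qed
  ultimately have "((\<lambda>x. if x \<in> U then wedge F G x else 0) has_integral 0) UNIV" by simp
  then show ?thesis by (simp add: has_integral_restrict_UNIV)
qed

section \<open>Integration over open sets and change of variables\<close>

lemma absolutely_integrable_compact_support:
  fixes h :: "'a::euclidean_space \<Rightarrow> real"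
  assumes "continuous_on U h" "compact K" "K \<subseteq> U" "\<And>x. x \<in> U \<Longrightarrow> x \<notin> K \<Longrightarrow> h x = 0"
  shows "h absolutely_integrable_on U"
proof -
  have "integrable lborel (\<lambda>x. indicator K x *\<^sub>R h x)"
    by (rule borel_integrable_compact[OF assms(2) continuous_on_subset[OF assms(1,3)]])
  then have "integrable lebesgue (\<lambda>x. indicator K x *\<^sub>R h x)"
    by (simp add: integrable_completion)
  moreover have "(\<lambda>x. indicator K x *\<^sub>R h x) = (\<lambda>x. indicator U x *\<^sub>R h x)"
    using assms(3,4) by (auto simp: indicator_def fun_eq_iff)
  ultimately show ?thesis by (simp only: set_integrable_def)
qed

lemma integral_0_imp_0_on_open:
  fixes h :: "'a::euclidean_space \<Rightarrow> real"
  assumes U: "open U" and h: "continuous_on U h" "\<And>x. x \<in> U \<Longrightarrow> 0 \<le> h x"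
    and int: "(h has_integral 0) U" and x: "x \<in> U"
  shows "h x = 0"
proof -
  obtain a b where ab: "x \<in> box a b" "cbox a b \<subseteq> U"
    using open_contains_cbox[OF U x] by metis
  have hc: "continuous_on (cbox a b) h" using h(1) ab(2) continuous_on_subset by blast
  have "integral (cbox a b) h \<le> integral U h"
    by (rule integral_subset_le) (use ab h int hc in \<open>auto intro: integrable_continuous\<close>)
  moreover have "integral (cbox a b) h \<ge> 0"
    by (rule integral_nonneg) (use ab h hc in \<open>auto intro: integrable_continuous\<close>)
  ultimately have "integral (cbox a b) h = 0" using int by (simp add: integral_unique)
  then show ?thesis
    using integral_cbox_eq_0_iff[OF hc] ab h(2) box_subset_cbox by blast
qed

text \<open>The formula for vector-valued functions is applied in \<open>real^1\<close> and read off
  in its only coordinate.\<close>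

lemma integral_change_of_variables_real:
  fixes f :: "real^'m::{finite,wellorder} \<Rightarrow> real" and g :: "real^'m::_ \<Rightarrow> real^'m::_"
  assumes S: "S \<in> sets lebesgue"
    and der_g: "\<And>x. x \<in> S \<Longrightarrow> (g has_derivative g' x) (at x within S)"
    and inj: "inj_on g S" and f: "f absolutely_integrable_on (g ` S)"
  shows "integral (g ` S) f = integral S (\<lambda>x. \<bar>det (matrix (g' x))\<bar> * f (g x))"
proof -
  have "(\<lambda>x. vec (f x) :: real^1) absolutely_integrable_on (g ` S)"
    using f by (simp add: absolutely_integrable_on_1_iff)
  from integral_change_of_variables[OF S der_g inj disjI1[OF this]]
  have "(integral (g ` S) (\<lambda>x. vec (f x) :: real^1)) $ 1
    = (integral S (\<lambda>x. \<bar>det (matrix (g' x))\<bar> *\<^sub>R (vec (f (g x)) :: real^1))) $ 1" by simp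
  then show ?thesis by (simp add: integral_on_1_eq)
qed

section \<open>Alternating bilinear maps on the plane\<close>

text \<open>An alternating map on the plane is determined by one value. This yields the
  transformation laws of \<open>wedge\<close> and of the area density, and it allows the mean
  curvature identity to be checked on a single basis.\<close>

lemma alternating_plane:
  fixes B :: "real^2 \<Rightarrow> real^2 \<Rightarrow> 'b::real_vector"
  assumes B: "bilinear B" and alt: "\<And>x. B x x = 0"
  shows "B y z = (y$1 * z$2 - y$2 * z$1) *\<^sub>R B (axis 1 1) (axis 2 1)"
proof -
  let ?e = "axis 1 1 :: real^2" and ?f = "axis 2 1 :: real^2"
  note lins = bilinear_ladd[OF B] bilinear_radd[OF B] bilinear_lmul[OF B] bilinear_rmul[OF B]
  have ex: "z = (z$1) *\<^sub>R ?e + (z$2) *\<^sub>R ?f" for z :: "real^2"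
    by (simp add: vec_eq_iff forall_2 axis_def)
  have "B ?e ?f + B ?f ?e = 0"
    using alt[of "?e + ?f"] alt[of ?e] alt[of ?f] by (simp add: lins add.commute)
  then have "B ?f ?e = - B ?e ?f" by (simp add: eq_neg_iff_add_eq_0 add.commute)
  then show ?thesis
    by (subst ex[of y], subst ex[of z]) (simp add: lins alt algebra_simps)
qed

lemma alternating_linear_det:
  fixes B :: "real^2 \<Rightarrow> real^2 \<Rightarrow> 'b::real_vector" and L :: "real^2 \<Rightarrow> real^2"
  assumes "bilinear B" "\<And>x. B x x = 0"
  shows "B (L (axis 1 1)) (L (axis 2 1)) = det (matrix L) *\<^sub>R B (axis 1 1) (axis 2 1)"
  using alternating_plane[OF assms, of "L (axis 1 1)" "L (axis 2 1)"]
  by (simp add: det_2 matrix_def mult.commute)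

lemma alternating_plane_0:
  fixes B :: "real^2 \<Rightarrow> real^2 \<Rightarrow> 'b::real_vector"
  assumes B: "bilinear B" "\<And>x. B x x = 0" and ab: "a \<noteq> b" "independent {a, b}" "B a b = 0"
  shows "B (axis 1 1) (axis 2 1) = 0"
proof -
  \<comment> \<open>If the determinant vanished, \<open>b\<close> would be a multiple of
    \<open>a\<close>, as division by a nonzero coordinate of \<open>a\<close> shows.\<close>
  have "a$1 * b$2 - a$2 * b$1 \<noteq> 0"
  proof
    assume det0: "a$1 * b$2 - a$2 * b$1 = 0"
    have "b \<notin> span {a}" "a \<noteq> 0"
      using ab(1,2) independent_insert[of b "{a}"] dependent_zero[of "{a, b}"] by (auto simp: insert_commute)
    moreover have "b = (b$1 / a$1) *\<^sub>R a" if "a$1 \<noteq> 0"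
      using that det0 by (simp add: vec_eq_iff forall_2 field_simps)
    moreover have "b = (b$2 / a$2) *\<^sub>R a" if "a$2 \<noteq> 0"
      using that det0 by (simp add: vec_eq_iff forall_2 field_simps)
    ultimately have "a$1 = 0" "a$2 = 0" by (metis span_base span_mul singletonI)+
    then show False using \<open>a \<noteq> 0\<close> by (simp add: vec_eq_iff forall_2)
  qed
  then show ?thesis using alternating_plane[OF B, of a b] ab(3) by simp
qed

section \<open>Bump functions of class C1\<close>

text \<open>Squaring is what makes the derivative \<open>2 * max 0 t\<close> continuous across
  0.\<close>

lemma C1_on_max_square: "C1_on UNIV (\<lambda>t::real. (max 0 t)\<^sup>2)"
proof (rule C1_onI)
  have "((\<lambda>t. (max 0 t)\<^sup>2) has_real_derivative 2 * max 0 t) (at t)" for t :: real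
  proof (cases t "0::real" rule: linorder_cases)
    case less
    have "((\<lambda>t::real. 0) has_real_derivative 2 * max 0 t) (at t)" using less by simp
    then show ?thesis
      by (rule has_field_derivative_transform_within_open[of _ _ _ "{..<0}"]) (use less in auto)
  next
    case greater
    have "((\<lambda>t::real. t\<^sup>2) has_real_derivative 2 * max 0 t) (at t)"
      using greater by (auto intro!: derivative_eq_intros)
    then show ?thesis
      by (rule has_field_derivative_transform_within_open[of _ _ _ "{0<..}"]) (use greater in auto)
  next
    case equal
    have "((\<lambda>h::real. (max 0 h)\<^sup>2 / h) \<longlongrightarrow> 0) (at 0)"
    proof (rule Lim_null_comparison)
      show "\<forall>\<^sub>F h in at 0. norm ((max 0 h)\<^sup>2 / h) \<le> \<bar>h\<bar>" for h :: real
        by (auto simp: max_def power2_eq_square intro!: always_eventually)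
      show "((\<lambda>h::real. \<bar>h\<bar>) \<longlongrightarrow> 0) (at 0)" by (intro tendsto_rabs_zero tendsto_ident_at)
    qed
    then show ?thesis using equal by (simp add: has_field_derivative_iff)
  qed
  then show "((\<lambda>t. (max 0 t)\<^sup>2) has_derivative (\<lambda>h. 2 * max 0 t * h)) (at t)" for t :: real
    by (simp add: has_field_derivative_def)
  show "continuous_on UNIV (\<lambda>t::real. 2 * max 0 t * w)" for w by (intro continuous_intros)
qed

text \<open>The squared distance is used because, unlike the distance, it is differentiable at the
  centre \<open>p\<close>.\<close>

definition bump :: "'a::euclidean_space \<Rightarrow> real \<Rightarrow> 'a \<Rightarrow> real" where
  "bump p r x = (max 0 (r\<^sup>2 - (x - p) \<bullet> (x - p)))\<^sup>2"

lemma bump_C1: "C1_on UNIV (bump p r)"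
proof -
  have "C1_on UNIV (\<lambda>x. r\<^sup>2 - (x - p) \<bullet> (x - p))"
  proof (rule C1_onI)
    show "((\<lambda>x. r\<^sup>2 - (x - p) \<bullet> (x - p)) has_derivative (\<lambda>h. - (2 * (h \<bullet> (x - p))))) (at x)" for x
      by (auto intro!: derivative_eq_intros simp: inner_commute)
    show "continuous_on UNIV (\<lambda>x. - (2 * (w \<bullet> (x - p))))" for w by (intro continuous_intros)
  qed
  from C1_on_compose[OF this C1_on_max_square] show ?thesis by (simp add: bump_def[abs_def])
qed

lemma bump_nonneg: "0 \<le> bump p r x"
  by (simp add: bump_def)

lemma bump_pos: "x \<in> ball p r \<Longrightarrow> 0 < bump p r x"
proof -
  assume "x \<in> ball p r"
  then have "norm (x - p) < r" by (simp add: dist_norm norm_minus_commute)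
  then have "(norm (x - p))\<^sup>2 < r\<^sup>2" by (intro power_strict_mono) auto
  then show ?thesis by (simp add: bump_def power2_norm_eq_inner max_def)
qed

lemma bump_0: "0 \<le> r \<Longrightarrow> x \<notin> cball p r \<Longrightarrow> bump p r x = 0"
proof -
  assume "0 \<le> r" "x \<notin> cball p r"
  then have "(norm (x - p))\<^sup>2 \<ge> r\<^sup>2" by (intro power_mono) (auto simp: dist_norm norm_minus_commute)
  then show ?thesis by (simp add: bump_def power2_norm_eq_inner max_def)
qed

section \<open>Stokes' theorem on closed surfaces\<close>

locale closed_surface =
  fixes X :: "'a topology" and A :: "'a param set"
  assumes closed_oriented_surface: "closed_oriented_surface X A"
begin

section \<open>Charts and transition maps\<close>

lemma oriented_surface: "oriented_surface X A"
  using closed_oriented_surface by (simp add: closed_oriented_surface_def)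

lemma Hausdorff: "Hausdorff_space X" and connected: "connected_space X" and nonempty: "topspace X \<noteq> {}"
  using oriented_surface by (auto simp: oriented_surface_def)

lemma compact: "compact_space X"
  using closed_oriented_surface by (simp add: closed_oriented_surface_def)

lemma covered: "x \<in> topspace X \<Longrightarrow> \<exists>c\<in>A. \<exists>u\<in>fst c. snd c u = x"
proof -
  assume "x \<in> topspace X"
  moreover have "topspace X = (\<Union>(U, \<phi>)\<in>A. \<phi> ` U)"
    using oriented_surface by (simp add: oriented_surface_def)
  ultimately obtain U \<phi> where "(U, \<phi>) \<in> A" "x \<in> \<phi> ` U" by auto
  then show ?thesis by (intro bexI[of _ "(U, \<phi>)"]) auto
qed

lemma local_param: "c \<in> A \<Longrightarrow> local_param X c"
  using oriented_surface by (auto simp: oriented_surface_def)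

lemma chart_open: "c \<in> A \<Longrightarrow> open (fst c)"
  using local_param[of c] by (auto simp: local_param_def)

lemma chart_homeo:
  "c \<in> A \<Longrightarrow> homeomorphic_map (top_of_set (fst c)) (subtopology X (snd c ` fst c)) (snd c)"
  using local_param[of c] by (auto simp: local_param_def)

lemma chart_image_open: "c \<in> A \<Longrightarrow> openin X (snd c ` fst c)"
  using local_param[of c] by (auto simp: local_param_def)

lemma chart_topspace: "c \<in> A \<Longrightarrow> u \<in> fst c \<Longrightarrow> snd c u \<in> topspace X"
  using chart_image_open openin_subset by blast

lemma chart_inj: "c \<in> A \<Longrightarrow> inj_on (snd c) (fst c)"
  using chart_homeo[of c] by (auto simp: homeomorphic_eq_everything_map)

lemma chart_continuous: "c \<in> A \<Longrightarrow> continuous_map (top_of_set (fst c)) X (snd c)"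
  using chart_homeo[of c] homeomorphic_imp_continuous_map continuous_map_in_subtopology by blast

lemma chart_preimage_open:
  assumes "c \<in> A" "openin X V" shows "open {u \<in> fst c. snd c u \<in> V}"
  using openin_continuous_map_preimage[OF chart_continuous[OF assms(1)] assms(2)] chart_open[OF assms(1)]
  by (simp add: openin_open_eq)

lemma chart_open_image:
  assumes "c \<in> A" "open V" "V \<subseteq> fst c" shows "openin X (snd c ` V)"
proof -
  have "openin (top_of_set (fst c)) V" using assms chart_open by (simp add: openin_open_eq)
  then have "openin (subtopology X (snd c ` fst c)) (snd c ` V)"
    using chart_homeo[OF assms(1)] homeomorphic_imp_open_map open_map_def by blast
  then show ?thesis using chart_image_open[OF assms(1)] openin_trans_full by blast
qed

text \<open>The Hausdorff property enters here. Closedness of these images is what allows a function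
  supported in one chart to be extended by 0 over the surface.\<close>

lemma chart_compact_image:
  assumes "c \<in> A" "compact K" "K \<subseteq> fst c" shows "closedin X (snd c ` K)"
proof -
  have "compactin (top_of_set (fst c)) K" using assms by (simp add: compactin_subtopology)
  then show ?thesis
    using image_compactin chart_continuous[OF assms(1)] compactin_imp_closedin[OF Hausdorff] by blast
qed

lemma overlap_open: "c \<in> A \<Longrightarrow> d \<in> A \<Longrightarrow> open (overlap c d)"
  unfolding overlap_def using chart_preimage_open chart_image_open by blast

lemma transition:
  assumes "u \<in> overlap c d"
  shows "transition c d u \<in> fst d" "snd d (transition c d u) = snd c u"
  using assms unfolding overlap_def transition_def
  by (auto intro: inv_into_into f_inv_into_f)

lemma transition_eq:
  assumes "d \<in> A" "y \<in> fst d" "snd d y = snd c u" shows "transition c d u = y"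
  using assms inv_into_f_f[OF chart_inj] unfolding transition_def by metis

lemma transition_image:
  assumes "c \<in> A" "d \<in> A" shows "transition c d ` overlap c d = overlap d c"
proof
  show "transition c d ` overlap c d \<subseteq> overlap d c"
  proof (rule image_subsetI)
    fix u assume u: "u \<in> overlap c d"
    then have "snd c u \<in> snd c ` fst c" by (auto simp: overlap_def)
    then show "transition c d u \<in> overlap d c" using transition[OF u] by (simp add: overlap_def)
  qed
next
  show "overlap d c \<subseteq> transition c d ` overlap c d"
  proof
    fix y assume y: "y \<in> overlap d c"
    then have yd: "y \<in> fst d" by (simp add: overlap_def)
    define u where "u = transition d c y"
    have u: "u \<in> fst c" "snd c u = snd d y" unfolding u_def using transition[OF y] by auto
    then have "u \<in> overlap c d" using yd by (auto simp: overlap_def)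
    moreover have "transition c d u = y" using transition_eq[OF assms(2) yd] u(2) by metis
    ultimately show "y \<in> transition c d ` overlap c d" by blast
  qed
qed

lemma transition_inj: "c \<in> A \<Longrightarrow> d \<in> A \<Longrightarrow> inj_on (transition c d) (overlap c d)"
proof (rule inj_onI)
  fix u u' assume c: "c \<in> A" and uu: "u \<in> overlap c d" "u' \<in> overlap c d" "transition c d u = transition c d u'"
  then have "snd c u = snd c u'" using transition(2) by metis
  then show "u = u'" using inj_onD[OF chart_inj[OF c]] uu by (auto simp: overlap_def)
qed

lemma transition_C1: "c \<in> A \<Longrightarrow> d \<in> A \<Longrightarrow> C1_on (overlap c d) (transition c d)"
  using oriented_surface smooth_on_C1 unfolding oriented_surface_def by blast

lemma transition_det:
  "c \<in> A \<Longrightarrow> d \<in> A \<Longrightarrow> u \<in> overlap c d \<Longrightarrow> 0 < det (matrix (D (transition c d) u))"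
  using oriented_surface unfolding oriented_surface_def jacobian_def by blast

section \<open>Functions and two-forms under change of chart\<close>

definition C1_map :: "('a \<Rightarrow> 'b::real_normed_vector) \<Rightarrow> bool" where
  "C1_map F \<longleftrightarrow> (\<forall>c\<in>A. C1_on (fst c) (\<lambda>u. F (snd c u)))"

lemma C1_mapD: "C1_map F \<Longrightarrow> c \<in> A \<Longrightarrow> C1_on (fst c) (\<lambda>u. F (snd c u))"
  by (simp add: C1_map_def)

lemma D_transition:
  fixes F :: "'a \<Rightarrow> 'b::real_normed_vector"
  assumes c: "c \<in> A" and d: "d \<in> A" and u: "u \<in> overlap c d" and F: "C1_map F"
  shows "D (\<lambda>u. F (snd c u)) u w = D (\<lambda>u. F (snd d u)) (transition c d u) (D (transition c d) u w)"
proof -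
  have "((\<lambda>u. F (snd d (transition c d u))) has_derivative
     (\<lambda>w. D (\<lambda>u. F (snd d u)) (transition c d u) (D (transition c d) u w))) (at u)"
    using diff_chain_at[OF C1_on_D[OF transition_C1[OF c d] u] C1_on_D[OF C1_mapD[OF F d] transition(1)[OF u]]]
    by (simp add: o_def)
  moreover have "D (\<lambda>u. F (snd c u)) u = D (\<lambda>u. F (snd d (transition c d u))) u"
    by (rule D_cong_open[OF overlap_open[OF c d] u]) (simp add: transition(2))
  ultimately show ?thesis by (simp add: D_eq)
qed

text \<open>This is the transformation law of the coefficient of a two-form: by the chain rule the
  left side is an alternating map evaluated at the images of the two unit vectors under the
  derivative of the transition.\<close>

lemma wedge_transition:
  fixes F G :: "'a \<Rightarrow> 'b::real_inner"
  assumes c: "c \<in> A" and d: "d \<in> A" and u: "u \<in> overlap c d" and F: "C1_map F" and G: "C1_map G"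
  shows "wedge (\<lambda>u. F (snd c u)) (\<lambda>u. G (snd c u)) u
    = det (matrix (D (transition c d) u)) * wedge (\<lambda>u. F (snd d u)) (\<lambda>u. G (snd d u)) (transition c d u)"
proof -
  let ?f = "D (\<lambda>u. F (snd d u)) (transition c d u)" and ?g = "D (\<lambda>u. G (snd d u)) (transition c d u)"
  define B where "B y z = ?f y \<bullet> ?g z - ?f z \<bullet> ?g y" for y z
  have lin: "linear ?f" "linear ?g"
    using C1_on_D[OF C1_mapD[OF F d] transition(1)[OF u]] C1_on_D[OF C1_mapD[OF G d] transition(1)[OF u]]
      has_derivative_linear by blast+
  have "bilinear B"
    unfolding bilinear_def B_def
    by (auto intro!: linearI simp: linear_add[OF lin(1)] linear_add[OF lin(2)]
        linear_cmul[OF lin(1)] linear_cmul[OF lin(2)] inner_add_left inner_add_right algebra_simps)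
  moreover have "B y y = 0" for y by (simp add: B_def)
  ultimately show ?thesis
    using alternating_linear_det[of B "D (transition c d) u"]
    by (simp add: wedge_def D_transition[OF c d u F] D_transition[OF c d u G] B_def)
qed

section \<open>Partition of unity\<close>

definition chart_bump :: "'a param \<Rightarrow> real^2 \<Rightarrow> real \<Rightarrow> 'a \<Rightarrow> real" where
  "chart_bump c p r x = (if x \<in> snd c ` fst c then bump p r (inv_into (fst c) (snd c) x) else 0)"

lemma chart_bump_nonneg: "0 \<le> chart_bump c p r x"
  by (simp add: chart_bump_def bump_nonneg)

lemma chart_bump_pos:
  assumes "c \<in> A" "u \<in> fst c" "u \<in> ball p r" shows "0 < chart_bump c p r (snd c u)"
  using assms bump_pos by (simp add: chart_bump_def inv_into_f_f[OF chart_inj])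

lemma chart_bump_0:
  assumes "0 \<le> r" "x \<notin> snd c ` cball p r" shows "chart_bump c p r x = 0"
proof (cases "x \<in> snd c ` fst c")
  case True
  then have "inv_into (fst c) (snd c) x \<notin> cball p r" using assms(2) f_inv_into_f[OF True] imageI by metis
  then show ?thesis using assms(1) by (simp add: chart_bump_def bump_0)
qed (simp add: chart_bump_def)

text \<open>A second chart \<open>d\<close> is covered by two open sets: the overlap with
  \<open>c\<close>, where the function is a bump composed with the transition, and the part lying
  off the closed image of \<open>cball p r\<close>, where it is 0.\<close>

lemma chart_bump_C1:
  assumes c: "c \<in> A" and r: "0 \<le> r" "cball p r \<subseteq> fst c" shows "C1_map (chart_bump c p r)"
  unfolding C1_map_def
proof
  fix d assume d: "d \<in> A"
  let ?V = "{u \<in> fst d. snd d u \<in> topspace X - snd c ` cball p r}"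
  have V: "open ?V"
    by (rule chart_preimage_open[OF d]) (use chart_compact_image[OF c _ r(2)] in auto)
  have "C1_on (overlap d c) (\<lambda>u. bump p r (transition d c u))"
    by (rule C1_on_compose[OF transition_C1[OF d c] bump_C1]) auto
  then have 1: "C1_on (overlap d c) (\<lambda>u. chart_bump c p r (snd d u))"
    by (rule C1_on_cong_open[OF _ overlap_open[OF d c]])
      (auto simp: chart_bump_def overlap_def transition_def)
  have 2: "C1_on ?V (\<lambda>u. chart_bump c p r (snd d u))"
    by (rule C1_on_cong_open[OF C1_on_const V]) (use chart_bump_0[OF r(1)] in auto)
  have "fst d = overlap d c \<union> ?V"
    using chart_topspace[OF d] r(2) by (auto simp: overlap_def)
  then show "C1_on (fst d) (\<lambda>u. chart_bump c p r (snd d u))"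
    using C1_on_Un_open[OF overlap_open[OF d c] V 1 2] by simp
qed

text \<open>Finitely many bumps, positive together on the whole surface by compactness, are divided
  by their sum. An index records chart, centre and radius, so that the support can be
  located.\<close>

lemma C1_partition_of_unity:
  obtains I :: "('a param \<times> (real^2) \<times> real) set" and \<rho> where
    "finite I"
    "\<And>c p r. (c, p, r) \<in> I \<Longrightarrow> c \<in> A \<and> cball p r \<subseteq> fst c"
    "\<And>i. i \<in> I \<Longrightarrow> C1_map (\<rho> i)"
    "\<And>i x. i \<in> I \<Longrightarrow> (0::real) \<le> \<rho> i x"
    "\<And>c p r x. (c, p, r) \<in> I \<Longrightarrow> x \<notin> snd c ` cball p r \<Longrightarrow> \<rho> (c, p, r) x = 0"
    "\<And>x. x \<in> topspace X \<Longrightarrow> (\<Sum>i\<in>I. \<rho> i x) = 1"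
proof -
  define J where "J = {(c, p, r). c \<in> A \<and> 0 < r \<and> cball p r \<subseteq> fst c}"
  define b where "b = (\<lambda>(c, p, r). chart_bump c p r)"
  \<comment> \<open>Open balls serve for the covering, since their images are open and the bumps are
    positive there; the supports lie in the images of the closed balls.\<close>
  define img where "img = (\<lambda>(c :: 'a param, p, r). snd c ` ball p r)"
  have "\<forall>V\<in>img ` J. openin X V"
  proof
    fix V assume "V \<in> img ` J"
    then obtain c p r where V: "V = snd c ` ball p r" "c \<in> A" "cball p r \<subseteq> fst c"
      by (auto simp: J_def img_def)
    then show "openin X V" using chart_open_image[of c "ball p r"] ball_subset_cball by blast
  qed
  moreover have "topspace X \<subseteq> \<Union> (img ` J)"
  proof
    fix x assume "x \<in> topspace X"
    then obtain c u where c: "c \<in> A" "u \<in> fst c" "snd c u = x" using covered by blast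
    obtain r where r: "0 < r" "cball u r \<subseteq> fst c"
      using chart_open[OF c(1)] c(2) open_contains_cball by blast
    have "(c, u, r) \<in> J" using c r by (simp add: J_def)
    moreover have "x \<in> img (c, u, r)" using c r by (auto simp: img_def)
    ultimately show "x \<in> \<Union> (img ` J)" by blast
  qed
  ultimately obtain \<F> where "finite \<F>" "\<F> \<subseteq> img ` J" "topspace X \<subseteq> \<Union> \<F>"
    using compact[unfolded compact_space_alt, rule_format, of "img ` J"] by auto
  moreover obtain I where "I \<subseteq> J" "finite I" "\<F> = img ` I"
    using finite_subset_image[OF \<open>finite \<F>\<close> \<open>\<F> \<subseteq> img ` J\<close>] by auto
  ultimately have I: "finite I" "I \<subseteq> J" "topspace X \<subseteq> \<Union> (img ` I)" by auto
  have IJ: "c \<in> A" "0 < r" "cball p r \<subseteq> fst c" if "(c, p, r) \<in> I" for c p r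
    using I(2) that by (auto simp: J_def)
  define s where "s x = (\<Sum>i\<in>I. b i x)" for x
  have b_nonneg: "0 \<le> b i x" for i x by (simp add: b_def chart_bump_nonneg split: prod.split)
  have b_C1: "C1_map (b i)" if "i \<in> I" for i
  proof -
    obtain c p r where cpr: "i = (c, p, r)" by (cases i)
    have "(c, p, r) \<in> I" using that cpr by simp
    from chart_bump_C1[OF IJ(1)[OF this] less_imp_le[OF IJ(2)[OF this]] IJ(3)[OF this]]
    show ?thesis by (simp add: b_def cpr)
  qed
  have s_pos: "0 < s x" if x: "x \<in> topspace X" for x
  proof -
    obtain i where i: "i \<in> I" "x \<in> img i" using I(3) x by blast
    obtain c p r where cpr: "i = (c, p, r)" by (cases i)
    obtain u where u: "u \<in> ball p r" "x = snd c u" using i cpr by (auto simp: img_def)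
    have "u \<in> fst c" using IJ(3) i(1) u(1) cpr ball_subset_cball by blast
    then have "0 < b i x" using chart_bump_pos[OF IJ(1)] i(1) cpr u by (simp add: b_def)
    also have "b i x \<le> s x" unfolding s_def using I(1) i(1) b_nonneg by (intro member_le_sum) auto
    finally show ?thesis .
  qed
  define \<rho> where "\<rho> i x = b i x * inverse (s x)" for i x
  show thesis
  proof (rule that[OF I(1)])
    show "C1_map (\<rho> i)" if "i \<in> I" for i
      unfolding C1_map_def
    proof
      fix c assume c: "c \<in> A"
      have "C1_on (fst c) (\<lambda>u. s (snd c u))"
        unfolding s_def using b_C1 C1_mapD c by (intro C1_on_sum) blast
      then have "C1_on (fst c) (\<lambda>u. inverse (s (snd c u)))"
        using s_pos[OF chart_topspace[OF c]] by (intro C1_on_inverse) (auto simp: less_imp_neq[THEN not_sym])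
      then show "C1_on (fst c) (\<lambda>u. \<rho> i (snd c u))"
        unfolding \<rho>_def by (intro C1_on_bilinear[OF bounded_bilinear_mult] C1_mapD[OF b_C1[OF that] c])
    qed
    show "0 \<le> \<rho> i x" for i x
    proof -
      have "0 \<le> s x" unfolding s_def by (intro sum_nonneg b_nonneg)
      then show ?thesis by (simp add: \<rho>_def b_nonneg)
    qed
    show "\<rho> (c, p, r) x = 0" if "(c, p, r) \<in> I" "x \<notin> snd c ` cball p r" for c p r x
      using chart_bump_0[of r x c p] IJ(2)[OF that(1)] that(2) by (simp add: \<rho>_def b_def)
    show "(\<Sum>i\<in>I. \<rho> i x) = 1" if "x \<in> topspace X" for x
      using s_pos[OF that] by (simp add: \<rho>_def sum_distrib_right[symmetric] flip: s_def)
  qed (use IJ in auto)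
qed

section \<open>From the plane to the surface\<close>

text \<open>Both integrals reduce to the overlap. The orientation is used here: as the transition
  has positive determinant, the absolute value in the change of variables formula
  disappears.\<close>

lemma integral_chart_change:
  fixes f g :: "real^2 \<Rightarrow> real"
  assumes c: "c \<in> A" and d: "d \<in> A"
    and f0: "\<And>u. u \<in> fst c \<Longrightarrow> u \<notin> overlap c d \<Longrightarrow> f u = 0"
    and g0: "\<And>y. y \<in> fst d \<Longrightarrow> y \<notin> overlap d c \<Longrightarrow> g y = 0"
    and g: "g absolutely_integrable_on fst d"
    and fg: "\<And>u. u \<in> overlap c d \<Longrightarrow> f u = det (matrix (D (transition c d) u)) * g (transition c d u)"
  shows "integral (fst c) f = integral (fst d) g"
proof -
  have restrict: "integral (fst c) h = integral (overlap c d) h"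
    "h absolutely_integrable_on fst c \<longleftrightarrow> h absolutely_integrable_on overlap c d"
    if h: "\<forall>u\<in>fst c - overlap c d. h u = 0" for h :: "real^2 \<Rightarrow> real" and c d :: "'a param"
  proof -
    have eq: "(\<lambda>u. if u \<in> fst c then h u else 0) = (\<lambda>u. if u \<in> overlap c d then h u else 0)"
      using h by (auto simp: fun_eq_iff overlap_def)
    show "integral (fst c) h = integral (overlap c d) h"
      using arg_cong[OF eq, of "integral UNIV"] by (simp only: integral_restrict_UNIV)
    show "h absolutely_integrable_on fst c \<longleftrightarrow> h absolutely_integrable_on overlap c d"
      using arg_cong[OF eq, of "\<lambda>h. h absolutely_integrable_on UNIV"]
      by (simp only: absolutely_integrable_restrict_UNIV)
  qed
  have "integral (fst c) f = integral (overlap c d) f"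
    using f0 by (intro restrict(1)) blast
  also have "\<dots> = integral (overlap c d) (\<lambda>u. \<bar>det (matrix (D (transition c d) u))\<bar> * g (transition c d u))"
    by (rule integral_cong) (use fg transition_det[OF c d] in fastforce)
  also have "\<dots> = integral (transition c d ` overlap c d) g"
  proof (rule integral_change_of_variables_real[symmetric])
    show "overlap c d \<in> sets lebesgue" using overlap_open[OF c d] by auto
    show "(transition c d has_derivative D (transition c d) u) (at u within overlap c d)"
      if "u \<in> overlap c d" for u
      using C1_on_D[OF transition_C1[OF c d] that] has_derivative_at_withinI by blast
    show "inj_on (transition c d) (overlap c d)" by (rule transition_inj[OF c d])
    show "g absolutely_integrable_on transition c d ` overlap c d"
      using g g0 restrict(2)[of d c g] unfolding transition_image[OF c d] by blast
  qed
  also have "\<dots> = integral (fst d) g"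
    using g0 restrict(1)[of d c g] unfolding transition_image[OF c d] by simp
  finally show ?thesis .
qed

abbreviation chart_wedge :: "('a \<Rightarrow> 'b::real_inner) \<Rightarrow> ('a \<Rightarrow> 'b) \<Rightarrow> 'a param \<Rightarrow> real^2 \<Rightarrow> real" where
  "chart_wedge F G c \<equiv> wedge (\<lambda>u. F (snd c u)) (\<lambda>u. G (snd c u))"

lemma C1_map_scaleR:
  "C1_map \<rho> \<Longrightarrow> C1_map F \<Longrightarrow> C1_map (\<lambda>x. \<rho> x *\<^sub>R F x)"
  unfolding C1_map_def using C1_on_bilinear[OF bounded_bilinear_scaleR] by blast

text \<open>The wedge involves the derivative of \<open>F\<close>, so \<open>F\<close> has to vanish
  near the point and not only at it; closedness of \<open>C\<close> provides the
  neighbourhood.\<close>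

lemma chart_wedge_0:
  assumes c: "c \<in> A" and u: "u \<in> fst c" and C: "closedin X C" "snd c u \<notin> C"
    and F: "\<And>x. x \<notin> C \<Longrightarrow> F x = 0"
  shows "chart_wedge F G c u = 0"
proof -
  let ?V = "{u \<in> fst c. snd c u \<in> topspace X - C}"
  have "chart_wedge F G c u = wedge (\<lambda>u. 0) (\<lambda>u. G (snd c u)) u"
    by (rule wedge_cong_open[OF chart_preimage_open[OF c, of "topspace X - C"]])
      (use C u F chart_topspace[OF c] in auto)
  then show ?thesis by simp
qed

lemma wedge_sum:
  assumes "\<And>i. i \<in> I \<Longrightarrow> C1_on U (F i)" "u \<in> U"
  shows "(\<Sum>i\<in>I. wedge (F i) G u) = wedge (\<lambda>u. \<Sum>i\<in>I. F i u) G u"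
proof -
  have "D (\<lambda>u. \<Sum>i\<in>I. F i u) u = (\<lambda>h. \<Sum>i\<in>I. D (F i) u h)"
    by (intro D_eq has_derivative_sum C1_on_D[OF assms(1)] assms(2))
  then show ?thesis by (simp add: wedge_def inner_sum_left sum_subtractf)
qed

text \<open>Integrals over the surface are never defined: \<open>\<integral> \<rho>\<^sub>j d\<langle>\<rho>\<^sub>i F, dG\<rangle>\<close> can be computed both
  in the \<open>i\<close>-th and in the \<open>j\<close>-th chart. Summed over \<open>j\<close> in the \<open>i\<close>-th chart it gives the integral
  of a compactly supported exact form, which is \<open>0\<close>; summed over \<open>i\<close> in the \<open>j\<close>-th chart it gives
  \<open>\<integral> \<rho>\<^sub>j d\<langle>F, dG\<rangle>\<close>.\<close>

theorem nonneg_exact_form_0: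
  fixes F G :: "'a \<Rightarrow> 'b::euclidean_space"
  assumes F: "C1_map F" and G: "C1_map G"
    and GD: "\<And>c w. c \<in> A \<Longrightarrow> C1_on (fst c) (\<lambda>u. D (\<lambda>u. G (snd c u)) u w)"
    and nonneg: "\<And>c u. c \<in> A \<Longrightarrow> u \<in> fst c \<Longrightarrow> 0 \<le> chart_wedge F G c u"
    and c: "c \<in> A" and u: "u \<in> fst c"
  shows "chart_wedge F G c u = 0"
proof -
  obtain I and \<rho> where fin: "finite I"
    and I: "\<And>c p r. (c, p, r) \<in> I \<Longrightarrow> c \<in> A \<and> cball p r \<subseteq> fst c"
    and \<rho>: "\<And>i. i \<in> I \<Longrightarrow> C1_map (\<rho> i)" "\<And>i x. i \<in> I \<Longrightarrow> (0::real) \<le> \<rho> i x"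
    and \<rho>0: "\<And>c p r x. (c, p, r) \<in> I \<Longrightarrow> x \<notin> snd c ` cball p r \<Longrightarrow> \<rho> (c, p, r) x = 0"
    and sum1: "\<And>x. x \<in> topspace X \<Longrightarrow> (\<Sum>i\<in>I. \<rho> i x) = 1"
    using C1_partition_of_unity by blast
  define K where "K = (\<lambda>(c :: 'a param, p :: real^2, r). cball p r)"
  define ch :: "'a param \<times> (real^2) \<times> real \<Rightarrow> 'a param" where "ch = fst"
  define \<rho>F where "\<rho>F i x = \<rho> i x *\<^sub>R F x" for i x
  have chA: "ch i \<in> A" and K: "compact (K i)" "K i \<subseteq> fst (ch i)" if "i \<in> I" for i
    using I that by (cases i; auto simp: ch_def K_def)+
  have \<rho>_out: "\<rho> i x = 0" if "i \<in> I" "x \<notin> snd (ch i) ` K i" for i x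
    using \<rho>0 that by (cases i) (auto simp: ch_def K_def)
  have \<rho>F: "C1_map (\<rho>F i)" if "i \<in> I" for i
    unfolding \<rho>F_def by (rule C1_map_scaleR[OF \<rho>(1)[OF that] F])
  have clo: "closedin X (snd (ch i) ` K i)" if "i \<in> I" for i
    by (rule chart_compact_image[OF chA[OF that] K[OF that]])
  have wedge_out: "chart_wedge (\<rho>F i) G c u = 0"
    if "i \<in> I" "c \<in> A" "u \<in> fst c" "snd c u \<notin> snd (ch i) ` K i" for i c u
    by (rule chart_wedge_0[OF that(2,3) clo[OF that(1)] that(4)])
      (simp add: \<rho>F_def \<rho>_out[OF that(1)])
  have \<rho>_cont: "continuous_on (fst c) (\<lambda>u. \<rho> i (snd c u))" if "i \<in> I" "c \<in> A" for i c
    using \<rho>(1) C1_mapD C1_on_continuous that by blast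
  have w_cont: "continuous_on (fst c) (chart_wedge H G c)" if "C1_map H" "c \<in> A" for H c
    using that C1_mapD G by (intro wedge_continuous) blast+
  \<comment> \<open>The factor \<open>\<rho> j\<close> confines the support to the
    \<open>j\<close>-th ball and \<open>\<rho>F i\<close> to the \<open>i\<close>-th one, so the
    function is compactly supported, hence integrable, in both charts.\<close>
  define h where "h i j c u = \<rho> j (snd c u) * chart_wedge (\<rho>F i) G c u" for i j c u
  have h_int: "h i j (ch k) absolutely_integrable_on fst (ch k)"
    if "i \<in> I" "j \<in> I" "k = i \<or> k = j" for i j k
  proof (rule absolutely_integrable_compact_support)
    have k: "k \<in> I" using that by auto
    show "continuous_on (fst (ch k)) (h i j (ch k))"
      unfolding h_def using that \<rho>_cont[OF _ chA[OF k]] w_cont[OF \<rho>F chA[OF k]]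
      by (intro continuous_intros) auto
    show "compact (K k)" "K k \<subseteq> fst (ch k)" by (rule K[OF k])+
    fix u assume u: "u \<in> fst (ch k)" "u \<notin> K k"
    have "snd (ch k) u \<notin> snd (ch k) ` K k"
      using chart_inj[OF chA[OF k]] u K[OF k] by (metis inj_on_image_mem_iff)
    then show "h i j (ch k) u = 0"
      using that \<rho>_out[OF k] wedge_out[OF k chA[OF k] u(1)] by (auto simp: h_def)
  qed
  have swap: "integral (fst (ch i)) (h i j (ch i)) = integral (fst (ch j)) (h i j (ch j))"
    if i: "i \<in> I" and j: "j \<in> I" for i j
  proof (rule integral_chart_change[OF chA[OF i] chA[OF j]])
    show "h i j (ch i) u = 0" if "u \<in> fst (ch i)" "u \<notin> overlap (ch i) (ch j)" for u
    proof -
      have "snd (ch i) u \<notin> snd (ch j) ` K j" using that K(2)[OF j] by (auto simp: overlap_def)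
      then show ?thesis using \<rho>_out[OF j] by (simp add: h_def)
    qed
    show "h i j (ch j) u = 0" if "u \<in> fst (ch j)" "u \<notin> overlap (ch j) (ch i)" for u
    proof -
      have "snd (ch j) u \<notin> snd (ch i) ` K i" using that K(2)[OF i] by (auto simp: overlap_def)
      then show ?thesis using wedge_out[OF i chA[OF j] that(1)] by (simp add: h_def)
    qed
    show "h i j (ch j) absolutely_integrable_on fst (ch j)" using h_int[OF i j] by blast
    show "h i j (ch i) u = det (matrix (D (transition (ch i) (ch j)) u)) * h i j (ch j) (transition (ch i) (ch j) u)"
      if "u \<in> overlap (ch i) (ch j)" for u
      using wedge_transition[OF chA[OF i] chA[OF j] that \<rho>F[OF i] G] transition(2)[OF that]
      by (simp add: h_def)
  qed
  have row: "(\<Sum>j\<in>I. integral (fst (ch i)) (h i j (ch i))) = 0" if i: "i \<in> I" for i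
  proof -
    have "(\<Sum>j\<in>I. integral (fst (ch i)) (h i j (ch i))) = integral (fst (ch i)) (\<lambda>u. \<Sum>j\<in>I. h i j (ch i) u)"
      by (rule integral_sum[symmetric])
        (use fin h_int[OF i] set_lebesgue_integral_eq_integral(1) in blast)+
    also have "\<dots> = integral (fst (ch i)) (chart_wedge (\<rho>F i) G (ch i))"
      by (rule integral_cong)
        (simp add: h_def sum1[OF chart_topspace[OF chA[OF i]]] flip: sum_distrib_right)
    also have "\<dots> = 0"
    proof (rule integral_unique, rule wedge_integral_0)
      show "open (fst (ch i))" by (rule chart_open[OF chA[OF i]])
      show "compact (K i)" "K i \<subseteq> fst (ch i)" by (rule K[OF i])+
      show "C1_on (fst (ch i)) (\<lambda>u. \<rho>F i (snd (ch i) u))" by (rule C1_mapD[OF \<rho>F[OF i] chA[OF i]])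
      show "\<rho>F i (snd (ch i) u) = 0" if "u \<in> fst (ch i)" "u \<notin> K i" for u
      proof -
        have "snd (ch i) u \<notin> snd (ch i) ` K i"
          using chart_inj[OF chA[OF i]] that K[OF i] by (metis inj_on_image_mem_iff)
        then show ?thesis by (simp add: \<rho>F_def \<rho>_out[OF i])
      qed
    qed (use C1_mapD[OF G chA[OF i]] GD[OF chA[OF i]] in auto)
    finally show ?thesis .
  qed
  define f where "f j u = \<rho> j (snd (ch j) u) * chart_wedge F G (ch j) u" for j u
  have f_sum: "f j u = (\<Sum>i\<in>I. h i j (ch j) u)" if j: "j \<in> I" and u: "u \<in> fst (ch j)" for j u
  proof -
    have "(\<Sum>i\<in>I. chart_wedge (\<rho>F i) G (ch j) u)
        = wedge (\<lambda>u. \<Sum>i\<in>I. \<rho>F i (snd (ch j) u)) (\<lambda>u. G (snd (ch j) u)) u"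
      by (rule wedge_sum[OF C1_mapD[OF \<rho>F chA[OF j]] u])
    also have "\<dots> = chart_wedge F G (ch j) u"
      by (rule wedge_cong_open[OF chart_open[OF chA[OF j]] u])
        (simp_all add: \<rho>F_def sum1[OF chart_topspace[OF chA[OF j]]] flip: scaleR_sum_left)
    finally show ?thesis by (simp add: f_def h_def flip: sum_distrib_left)
  qed
  have f_has: "(f j has_integral (\<Sum>i\<in>I. integral (fst (ch j)) (h i j (ch j)))) (fst (ch j))"
    if j: "j \<in> I" for j
  proof -
    have "((\<lambda>u. \<Sum>i\<in>I. h i j (ch j) u) has_integral (\<Sum>i\<in>I. integral (fst (ch j)) (h i j (ch j)))) (fst (ch j))"
      by (rule has_integral_sum[OF fin])
        (use h_int[OF _ j] set_lebesgue_integral_eq_integral(1) in blast)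
    then show ?thesis by (rule has_integral_eq[rotated]) (simp add: f_sum[OF j])
  qed
  have f_nonneg: "0 \<le> f j u" if "j \<in> I" "u \<in> fst (ch j)" for j u
    using \<rho>(2)[OF that(1)] nonneg[OF chA that(2)] that(1) by (simp add: f_def)
  have "(\<Sum>j\<in>I. integral (fst (ch j)) (f j)) = (\<Sum>j\<in>I. \<Sum>i\<in>I. integral (fst (ch j)) (h i j (ch j)))"
    by (rule sum.cong[OF refl]) (rule integral_unique[OF f_has])
  also have "\<dots> = (\<Sum>i\<in>I. \<Sum>j\<in>I. integral (fst (ch j)) (h i j (ch j)))" by (rule sum.swap)
  also have "\<dots> = (\<Sum>i\<in>I. \<Sum>j\<in>I. integral (fst (ch i)) (h i j (ch i)))"
    by (intro sum.cong refl swap[symmetric])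
  also have "\<dots> = 0" by (simp add: row)
  finally have "(\<Sum>j\<in>I. integral (fst (ch j)) (f j)) = 0" .
  moreover have "0 \<le> integral (fst (ch j)) (f j)" if "j \<in> I" for j
    using f_has[OF that] f_nonneg[OF that] by (intro integral_nonneg) (auto simp: has_integral_integrable)
  ultimately have "\<forall>j\<in>I. integral (fst (ch j)) (f j) = 0"
    using sum_nonneg_eq_0_iff[OF fin, of "\<lambda>j. integral (fst (ch j)) (f j)"] by simp
  then have int0: "(f j has_integral 0) (fst (ch j))" if "j \<in> I" for j
    using integrable_integral[OF has_integral_integrable[OF f_has[OF that]]] that by simp
  have f_cont: "continuous_on (fst (ch j)) (f j)" if "j \<in> I" for j
    unfolding f_def[abs_def]
    by (intro continuous_on_mult \<rho>_cont w_cont F that chA[OF that])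
  have f0: "f j y = 0" if "j \<in> I" "y \<in> fst (ch j)" for j y
    by (rule integral_0_imp_0_on_open[OF chart_open[OF chA[OF that(1)]] f_cont[OF that(1)]
          f_nonneg[OF that(1)] int0[OF that(1)] that(2)])
  \<comment> \<open>So far the form vanishes only in charts of the partition and only after
    multiplication by \<open>\<rho> j\<close>. Some \<open>\<rho> j\<close> is nonzero at the given
    point, and the transformation law carries the vanishing back to \<open>c\<close>.\<close>
  have "(\<Sum>i\<in>I. \<rho> i (snd c u)) \<noteq> 0" using sum1[OF chart_topspace[OF c u]] by simp
  then obtain j where j: "j \<in> I" "\<rho> j (snd c u) \<noteq> 0" by (meson sum.neutral)
  then have "snd c u \<in> snd (ch j) ` K j" using \<rho>_out by blast
  then have ov: "u \<in> overlap c (ch j)" using u K(2)[OF j(1)] by (auto simp: overlap_def)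
  have "f j (transition c (ch j) u) = 0" using f0[OF j(1) transition(1)[OF ov]] .
  then have "chart_wedge F G (ch j) (transition c (ch j) u) = 0"
    using j(2) transition(2)[OF ov] by (simp add: f_def)
  then show ?thesis using wedge_transition[OF c chA[OF j(1)] ov F G] by simp
qed

end

section \<open>Translating solitons\<close>

unbundle cross3_syntax

lemma bounded_bilinear_cross: "bounded_bilinear (\<times>)"
  using bilinear_cross by (simp only: bilinear_conv_bounded_bilinear)

text \<open>Orthogonality gives n x (x x y) = 0, and the double product with the unit vector
  \<open>n\<close> recovers the component orthogonal to \<open>n\<close> up to sign, so that
  component is 0.\<close>

lemma cross_of_orthogonal_unit:
  fixes n x y :: "real^3"
  assumes "norm n = 1" "n \<bullet> x = 0" "n \<bullet> y = 0"
  shows "x \<times> y = (n \<bullet> (x \<times> y)) *\<^sub>R n"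
proof -
  have "n \<times> (n \<times> (x \<times> y)) = (n \<bullet> (x \<times> y)) *\<^sub>R n - (n \<bullet> n) *\<^sub>R (x \<times> y)"
    by (rule Lagrange)
  moreover have "n \<times> (x \<times> y) = 0"
    using assms by (simp add: Lagrange)
  moreover have "n \<bullet> n = 1" using assms(1) by (simp add: norm_eq_1)
  ultimately show ?thesis by simp
qed

lemma cross_inj_nonzero:
  fixes f :: "real^2 \<Rightarrow> real^3"
  assumes f: "linear f" "inj f" shows "f (axis 1 1) \<times> f (axis 2 1) \<noteq> 0"
proof
  let ?e = "axis 1 1 :: real^2" and ?f = "axis 2 1 :: real^2"
  have inj0: "z = 0" if "f z = 0" for z
    using that f linear_injective_0 by blast
  have ne: "?f \<noteq> k *\<^sub>R ?e" "?e \<noteq> 0" "?f \<noteq> 0" for k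
    by (auto simp: vec_eq_iff forall_2 axis_def)
  assume "f ?e \<times> f ?f = 0"
  then consider "f ?e = 0" | "f ?f = 0" | k where "f ?f = k *\<^sub>R f ?e"
    by (auto simp: cross_eq_0 collinear_lemma)
  then show False
  proof cases
    case 3
    then have "f (?f - k *\<^sub>R ?e) = 0" by (simp add: linear_diff[OF f(1)] linear_cmul[OF f(1)])
    then show False using inj0 ne(1) by fastforce
  qed (use inj0 ne in blast)+
qed

context closed_surface
begin

section \<open>Signed area and mean curvature in charts\<close>

text \<open>For a unit normal \<open>N\<close> of an immersion this is the density of dA with a
  sign: positive where \<open>N\<close> agrees with the orientation of the chart, negative where it
  is opposite.\<close>

definition area_density :: "('a \<Rightarrow> real^3) \<Rightarrow> ('a \<Rightarrow> real^3) \<Rightarrow> 'a param \<Rightarrow> real^2 \<Rightarrow> real" where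
  "area_density \<psi> N c u = N (snd c u) \<bullet>
     (D (\<lambda>u. \<psi> (snd c u)) u (axis 1 1) \<times> D (\<lambda>u. \<psi> (snd c u)) u (axis 2 1))"

lemma smooth_map_C1: "smooth_map A f \<Longrightarrow> C1_map f"
  using smooth_on_C1 unfolding smooth_map_def C1_map_def by (fastforce simp: o_def)

lemma smooth_map_C1_D:
  assumes "smooth_map A f" "c \<in> A" shows "C1_on (fst c) (\<lambda>u. D (\<lambda>u. f (snd c u)) u w)"
proof -
  have "smooth_on (fst c) (\<lambda>u. f (snd c u))"
    using assms by (auto simp: smooth_map_def o_def)
  then show ?thesis by (rule smooth_on_C1_D)
qed

lemma linear_D:
  assumes "C1_map F" "c \<in> A" "u \<in> fst c" shows "linear (D (\<lambda>u. F (snd c u)) u)"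
  using C1_on_D[OF C1_mapD[OF assms(1,2)] assms(3)] has_derivative_linear by blast

text \<open>The factor is the same positive determinant as for \<open>wedge\<close>, so the sign of
  the density depends on the point of the surface and not on the chart.\<close>

lemma area_density_transition:
  assumes c: "c \<in> A" and d: "d \<in> A" and u: "u \<in> overlap c d" and \<psi>: "C1_map \<psi>"
  shows "area_density \<psi> N c u = det (matrix (D (transition c d) u)) * area_density \<psi> N d (transition c d u)"
proof -
  let ?f = "D (\<lambda>u. \<psi> (snd d u)) (transition c d u)"
  define B where "B y z = ?f y \<times> ?f z" for y z
  note lin = linear_D[OF \<psi> d transition(1)[OF u]]
  have "bilinear B"
    unfolding bilinear_def B_def
    by (auto intro!: linearI simp: linear_add[OF lin] linear_cmul[OF lin] cross_add_left cross_add_right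
        cross_mult_left cross_mult_right)
  moreover have "B y y = 0" for y by (simp add: B_def)
  ultimately show ?thesis
    using alternating_linear_det[of B "D (transition c d) u"]
    by (simp add: area_density_def D_transition[OF c d u \<psi>] B_def transition(2)[OF u])
qed

text \<open>The difference of both sides is an alternating bilinear map of the two tangent vectors, and it
  vanishes on a pair of eigenvectors of the shape operator.\<close>

lemma mean_curvature_cross:
  assumes \<psi>: "C1_map \<psi>" and N: "C1_map N" and c: "c \<in> A" and u: "u \<in> fst c"
    and H: "has_mean_curvature A \<psi> N (snd c u) H"
  shows "D (\<lambda>u. N (snd c u)) u (axis 1 1) \<times> D (\<lambda>u. \<psi> (snd c u)) u (axis 2 1)
       - D (\<lambda>u. N (snd c u)) u (axis 2 1) \<times> D (\<lambda>u. \<psi> (snd c u)) u (axis 1 1)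
       = - (2 * H) *\<^sub>R (D (\<lambda>u. \<psi> (snd c u)) u (axis 1 1) \<times> D (\<lambda>u. \<psi> (snd c u)) u (axis 2 1))"
proof -
  obtain \<kappa>1 \<kappa>2 where pc: "principal_curvatures A \<psi> N (snd c u) \<kappa>1 \<kappa>2" and Heq: "H = (\<kappa>1 + \<kappa>2) / 2"
    using H unfolding has_mean_curvature_def by blast
  then have H2: "2 * H = \<kappa>1 + \<kappa>2" by simp
  \<comment> \<open>The chart \<open>d\<close> carrying the eigenvectors may differ from
    \<open>c\<close>. The identity is proved in \<open>d\<close> for all pairs of vectors and then
    applied to the images of the unit vectors under the transition.\<close>
  obtain d y a b where d: "d \<in> A" and y: "y \<in> fst d" "snd d y = snd c u" and ab: "a \<noteq> b" "independent {a, b}"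
    and a: "- D (\<lambda>u. N (snd d u)) y a = \<kappa>1 *\<^sub>R D (\<lambda>u. \<psi> (snd d u)) y a"
    and b: "- D (\<lambda>u. N (snd d u)) y b = \<kappa>2 *\<^sub>R D (\<lambda>u. \<psi> (snd d u)) y b"
    using pc unfolding principal_curvatures_def o_def by (auto simp: case_prod_beta)
  have "snd c u \<in> snd d ` fst d" using y by (metis imageI)
  then have ov: "u \<in> overlap c d" using u by (simp add: overlap_def)
  have \<tau>: "transition c d u = y" by (rule transition_eq[OF d y])
  let ?f = "D (\<lambda>u. \<psi> (snd d u)) y" and ?n = "D (\<lambda>u. N (snd d u)) y"
  define B where "B y z = ?n y \<times> ?f z - ?n z \<times> ?f y + (2 * H) *\<^sub>R (?f y \<times> ?f z)" for y z
  note lf = linear_D[OF \<psi> d y(1)] and ln = linear_D[OF N d y(1)]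
  have "bilinear B"
    unfolding bilinear_def B_def
    by (auto intro!: linearI simp: linear_add[OF lf] linear_cmul[OF lf] linear_add[OF ln] linear_cmul[OF ln]
        cross_add_left cross_add_right cross_mult_left cross_mult_right algebra_simps)
  moreover have "B y y = 0" for y by (simp add: B_def)
  \<comment> \<open>On eigenvectors the three terms combine to
    \<open>2 * H - \<kappa>1 - \<kappa>2\<close> times the cross product of the two tangent
    vectors.\<close>
  moreover have "B a b = 0"
  proof -
    have "?n a = - \<kappa>1 *\<^sub>R ?f a" "?n b = - \<kappa>2 *\<^sub>R ?f b" using a b by (metis minus_minus scaleR_minus_left)+
    then show ?thesis
      using cross_skew[of "?f b" "?f a"]
      by (simp add: B_def cross_mult_left H2 scaleR_add_left)
  qed
  ultimately have "B (axis 1 1) (axis 2 1) = 0" using alternating_plane_0 ab by blast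
  then have "B (D (transition c d) u (axis 1 1)) (D (transition c d) u (axis 2 1)) = 0"
    using alternating_linear_det[OF \<open>bilinear B\<close>, of "D (transition c d) u"] by (simp add: B_def)
  then show ?thesis
    unfolding B_def D_transition[OF c d ov \<psi>] D_transition[OF c d ov N] \<tau>
    by (simp add: eq_neg_iff_add_eq_0)
qed

lemma continuous_on_surface:
  fixes f :: "'a \<Rightarrow> real"
  assumes "\<And>c. c \<in> A \<Longrightarrow> continuous_on (fst c) (\<lambda>u. f (snd c u))"
  shows "continuous_map X euclideanreal f"
  unfolding continuous_map_def
proof (intro conjI allI impI)
  fix S :: "real set" assume S: "openin euclideanreal S"
  have "{x \<in> topspace X. f x \<in> S} = (\<Union>c\<in>A. snd c ` (fst c \<inter> (\<lambda>u. f (snd c u)) -` S))"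
    using covered chart_topspace by fastforce
  moreover have "openin X (snd c ` (fst c \<inter> (\<lambda>u. f (snd c u)) -` S))" if "c \<in> A" for c
    using S continuous_open_preimage[OF assms[OF that] chart_open[OF that]]
    by (intro chart_open_image[OF that]) auto
  ultimately show "openin X {x \<in> topspace X. f x \<in> S}" by auto
qed auto

text \<open>A maximum exists by compactness, and it is interior to any chart around it because
  parameter domains are open.\<close>

lemma critical_point:
  fixes f :: "'a \<Rightarrow> real"
  assumes f: "C1_map f"
  obtains c u where "c \<in> A" "u \<in> fst c" "\<And>w. D (\<lambda>u. f (snd c u)) u w = 0"
proof -
  have "continuous_map X euclideanreal f"
    by (rule continuous_on_surface) (rule C1_on_continuous[OF C1_mapD[OF f]])
  then have "compactin euclideanreal (f ` topspace X)"
    using compact unfolding compact_space_def by (rule image_compactin[rotated])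
  then have "compact (f ` topspace X)" by simp
  then obtain x where x: "x \<in> topspace X" "\<And>y. y \<in> topspace X \<Longrightarrow> f y \<le> f x"
    using compact_attains_sup[of "f ` topspace X"] nonempty by auto
  obtain c u where c: "c \<in> A" "u \<in> fst c" "snd c u = x" using covered[OF x(1)] by blast
  have "D (\<lambda>u. f (snd c u)) u = (\<lambda>w. 0)"
    by (rule differential_zero_maxmin[OF c(2) chart_open[OF c(1)] C1_on_D[OF C1_mapD[OF f c(1)] c(2)]])
      (use x(2) chart_topspace[OF c(1)] c(3) in auto)
  then show thesis using that c by metis
qed

text \<open>The sets of positive and of negative density are open, disjoint and cover the surface,
  so connectedness leaves one of them empty.\<close>

lemma area_density_sign:
  assumes \<psi>: "C1_map \<psi>" and N: "C1_map N"
    and nz: "\<And>c u. c \<in> A \<Longrightarrow> u \<in> fst c \<Longrightarrow> area_density \<psi> N c u \<noteq> 0"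
  shows "(\<forall>c\<in>A. \<forall>u\<in>fst c. 0 < area_density \<psi> N c u) \<or> (\<forall>c\<in>A. \<forall>u\<in>fst c. area_density \<psi> N c u < 0)"
proof -
  \<comment> \<open>Taking \<open>s\<close> to be 1 or -1 treats the two signs by one
    argument.\<close>
  define P where "P s = (\<Union>c\<in>A. snd c ` {u \<in> fst c. 0 < s * area_density \<psi> N c u})" for s :: real
  have P_open: "openin X (P s)" for s
    unfolding P_def
  proof (rule openin_Union, clarify)
    fix c assume c: "(c :: 'a param) \<in> A"
    have "continuous_on (fst c) (\<lambda>u. s * area_density \<psi> N c u)"
      unfolding area_density_def using C1_on_continuous[OF C1_mapD[OF N c]] C1_on_cont_D[OF C1_mapD[OF \<psi> c]]
      by (intro continuous_intros continuous_on_cross)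
    then have "open (fst c \<inter> (\<lambda>u. s * area_density \<psi> N c u) -` {0<..})"
      by (rule continuous_open_preimage[OF _ chart_open[OF c]]) simp
    moreover have "fst c \<inter> (\<lambda>u. s * area_density \<psi> N c u) -` {0<..} = {u \<in> fst c. 0 < s * area_density \<psi> N c u}"
      by auto
    ultimately show "openin X (snd c ` {u \<in> fst c. 0 < s * area_density \<psi> N c u})"
      using chart_open_image[OF c] by auto
  qed
  have same: "0 < s * area_density \<psi> N d y \<longleftrightarrow> 0 < s * area_density \<psi> N c u"
    if "c \<in> A" "d \<in> A" "u \<in> fst c" "y \<in> fst d" "snd d y = snd c u" for c d u y s
  proof -
    have "snd c u \<in> snd d ` fst d" using that by (metis imageI)
    then have ov: "u \<in> overlap c d" using that by (simp add: overlap_def)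
    have "area_density \<psi> N c u = det (matrix (D (transition c d) u)) * area_density \<psi> N d y"
      using area_density_transition[OF that(1,2) ov \<psi>] transition_eq[OF that(2,4,5)] by simp
    then show ?thesis
      using transition_det[OF that(1,2) ov] by (auto simp add: zero_less_mult_iff mult_less_0_iff)
  qed
  have P_iff: "snd c u \<in> P s \<longleftrightarrow> 0 < s * area_density \<psi> N c u" if "c \<in> A" "u \<in> fst c" for c u s
  proof
    assume "snd c u \<in> P s"
    then obtain d y where "d \<in> A" "y \<in> fst d" "0 < s * area_density \<psi> N d y" "snd d y = snd c u"
      by (auto simp: P_def)
    then show "0 < s * area_density \<psi> N c u" using same[of c d u y s] that by blast
  next
    assume "0 < s * area_density \<psi> N c u"
    then show "snd c u \<in> P s" using that by (auto simp: P_def)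
  qed
  have "topspace X \<subseteq> P 1 \<union> P (-1)"
  proof
    fix x assume "x \<in> topspace X"
    then obtain c u where "c \<in> A" "u \<in> fst c" "snd c u = x" using covered by blast
    then show "x \<in> P 1 \<union> P (-1)" using nz[of c u] P_iff[of c u] by auto
  qed
  moreover have "P 1 \<inter> P (-1) = {}"
  proof -
    have False if "x \<in> P 1" "x \<in> P (-1)" for x
    proof -
      have "x \<in> topspace X" using that(1) P_open openin_subset by blast
      then obtain c u where "c \<in> A" "u \<in> fst c" "snd c u = x" using covered by blast
      then show False using that P_iff[of c u] by auto
    qed
    then show ?thesis by blast
  qed
  ultimately have "P 1 = {} \<or> P (-1) = {}"
    using connected P_open unfolding connected_space_def by blast
  then show ?thesis
  proof
    assume "P 1 = {}"
    then have "\<not> 0 < area_density \<psi> N c u" if "c \<in> A" "u \<in> fst c" for c u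
      using P_iff[OF that, of 1] by simp
    then show ?thesis using nz by (meson linorder_neqE_linordered_idom)
  next
    assume "P (-1) = {}"
    then have "\<not> area_density \<psi> N c u < 0" if "c \<in> A" "u \<in> fst c" for c u
      using P_iff[OF that, of "-1"] by simp
    then show ?thesis using nz by (meson linorder_neqE_linordered_idom)
  qed
qed

text \<open>The vector field \<open>W\<close> satisfies \<open>d\<langle>W, d\<psi>\<rangle> = 2 (H - c\<^sub>0) \<langle>N, v\<rangle> dA = \<langle>N, v\<rangle>\<^sup>2 dA\<close>.\<close>

lemma no_translating_soliton:
  assumes v: "norm v = 1" and sol: "translating_soliton c\<^sub>0 v X A \<psi> N"
  shows False
proof -
  have imm: "immersion A \<psi>" and gauss: "gauss_map A \<psi> N"
    and H: "\<And>p. p \<in> topspace X \<Longrightarrow> has_mean_curvature A \<psi> N p (c\<^sub>0 + (N p \<bullet> v) / 2)"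
    using sol by (auto simp: translating_soliton_def)
  have smooth: "smooth_map A \<psi>" "smooth_map A N"
    using imm gauss by (auto simp: immersion_def gauss_map_def)
  have \<psi>: "C1_map \<psi>" and N: "C1_map N" using smooth smooth_map_C1 by auto
  let ?\<psi> = "\<lambda>c. D (\<lambda>u. \<psi> (snd c u))" and ?N = "\<lambda>c. D (\<lambda>u. N (snd c u))"
  have unit: "norm (N (snd c u)) = 1" and orth: "N (snd c u) \<bullet> ?\<psi> c u w = 0"
    and inj: "inj (?\<psi> c u)" if "c \<in> A" "u \<in> fst c" for c u w
    using that gauss imm by (auto simp: gauss_map_def immersion_def o_def case_prod_beta)
  define J where "J = area_density \<psi> N"
  have cross_J: "?\<psi> c u (axis 1 1) \<times> ?\<psi> c u (axis 2 1) = J c u *\<^sub>R N (snd c u)"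
    if "c \<in> A" "u \<in> fst c" for c u
    unfolding J_def area_density_def using cross_of_orthogonal_unit unit[OF that] orth[OF that] by blast
  have J_nz: "J c u \<noteq> 0" if "c \<in> A" "u \<in> fst c" for c u
    using cross_inj_nonzero[OF linear_D[OF \<psi> that] inj[OF that]] cross_J[OF that] by auto
  define W where "W x = N x \<times> v - c\<^sub>0 *\<^sub>R (v \<times> \<psi> x)" for x
  have D_W: "((\<lambda>u. W (snd c u)) has_derivative (\<lambda>w. ?N c u w \<times> v - c\<^sub>0 *\<^sub>R (v \<times> ?\<psi> c u w))) (at u)"
    if "c \<in> A" "u \<in> fst c" for c u
    unfolding W_def
    by (intro has_derivative_diff has_derivative_scaleR_right
        bounded_linear.has_derivative[OF bounded_bilinear.bounded_linear_left[OF bounded_bilinear_cross] C1_on_D[OF C1_mapD[OF N]]]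
        bounded_linear.has_derivative[OF bounded_bilinear.bounded_linear_right[OF bounded_bilinear_cross] C1_on_D[OF C1_mapD[OF \<psi>]]] that)
  have W: "C1_map W"
    unfolding C1_map_def
  proof
    fix c assume c: "c \<in> A"
    show "C1_on (fst c) (\<lambda>u. W (snd c u))"
    proof (rule C1_onI[OF D_W[OF c]])
      show "continuous_on (fst c) (\<lambda>u. ?N c u w \<times> v - c\<^sub>0 *\<^sub>R (v \<times> ?\<psi> c u w))" for w
        by (intro continuous_on_diff continuous_on_scaleR continuous_on_const continuous_on_cross
            C1_on_cont_D[OF C1_mapD[OF N c]] C1_on_cont_D[OF C1_mapD[OF \<psi> c]])
    qed
  qed
  have wedge_W: "chart_wedge W \<psi> c u = (N (snd c u) \<bullet> v)\<^sup>2 * J c u" if "c \<in> A" "u \<in> fst c" for c u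
  proof -
    define n1 where "n1 = ?N c u (axis 1 1)"
    define n2 where "n2 = ?N c u (axis 2 1)"
    define e1 where "e1 = ?\<psi> c u (axis 1 1)"
    define e2 where "e2 = ?\<psi> c u (axis 2 1)"
    have "chart_wedge W \<psi> c u = (n1 \<times> v - c\<^sub>0 *\<^sub>R (v \<times> e1)) \<bullet> e2 - (n2 \<times> v - c\<^sub>0 *\<^sub>R (v \<times> e2)) \<bullet> e1"
      unfolding wedge_def D_eq[OF D_W[OF that]] n1_def n2_def e1_def e2_def by simp
    \<comment> \<open>Cyclic symmetry of the triple product; the two terms with
      \<open>c\<^sub>0\<close> reinforce each other, whence the factor 2.\<close>
    also have "\<dots> = - (v \<bullet> (n1 \<times> e2 - n2 \<times> e1)) - 2 * c\<^sub>0 * (v \<bullet> (e1 \<times> e2))"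
      by (simp add: cross3_simps)
    also have "n1 \<times> e2 - n2 \<times> e1 = - (2 * (c\<^sub>0 + (N (snd c u) \<bullet> v) / 2)) *\<^sub>R (e1 \<times> e2)"
      unfolding n1_def n2_def e1_def e2_def
      by (rule mean_curvature_cross[OF \<psi> N that H[OF chart_topspace[OF that]]])
    also have "e1 \<times> e2 = J c u *\<^sub>R N (snd c u)"
      unfolding e1_def e2_def by (rule cross_J[OF that])
    finally show ?thesis
      by (simp add: inner_commute algebra_simps power2_eq_square)
  qed
  have sign: "(\<forall>c\<in>A. \<forall>u\<in>fst c. 0 < J c u) \<or> (\<forall>c\<in>A. \<forall>u\<in>fst c. J c u < 0)"
    using area_density_sign[OF \<psi> N, folded J_def] J_nz by blast
  have zero: "(N (snd c u) \<bullet> v)\<^sup>2 * J c u = 0" if c: "c \<in> A" "u \<in> fst c" for c u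
    using sign
  proof
    assume pos: "\<forall>c\<in>A. \<forall>u\<in>fst c. 0 < J c u"
    have "chart_wedge W \<psi> c u = 0"
      by (rule nonneg_exact_form_0[OF W \<psi> smooth_map_C1_D[OF smooth(1)] _ c])
        (use pos in \<open>simp_all add: wedge_W less_imp_le\<close>)
    then show ?thesis using wedge_W[OF c] by simp
  next
    \<comment> \<open>Here \<open>N\<close> is opposite to the orientation and the form is
      nonpositive; replacing \<open>W\<close> by its negative restores the sign.\<close>
    assume neg: "\<forall>c\<in>A. \<forall>u\<in>fst c. J c u < 0"
    have minus: "chart_wedge (\<lambda>x. - W x) \<psi> c u = - chart_wedge W \<psi> c u" if "c \<in> A" "u \<in> fst c" for c u
      using D_eq[OF has_derivative_minus[OF C1_on_D[OF C1_mapD[OF W that(1)] that(2)]]]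
      by (simp add: wedge_def)
    have "C1_map (\<lambda>x. - W x)"
      using W C1_on_bounded_linear[OF bounded_linear_minus[OF bounded_linear_ident]] by (auto simp: C1_map_def)
    then have "chart_wedge (\<lambda>x. - W x) \<psi> c u = 0"
      by (rule nonneg_exact_form_0[OF _ \<psi> smooth_map_C1_D[OF smooth(1)] _ c])
        (use neg in \<open>simp_all add: minus wedge_W mult_nonneg_nonpos less_imp_le\<close>)
    then show ?thesis using minus[OF c] wedge_W[OF c] by simp
  qed
  have "C1_map (\<lambda>x. \<psi> x \<bullet> v)"
    using \<psi> C1_on_bounded_linear[OF bounded_linear_inner_left] by (auto simp: C1_map_def)
  then obtain c u where c: "c \<in> A" "u \<in> fst c" and crit: "\<And>w. D (\<lambda>u. \<psi> (snd c u) \<bullet> v) u w = 0"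
    using critical_point by blast
  have v_orth: "v \<bullet> ?\<psi> c u w = 0" for w
    using crit[of w] D_eq[OF bounded_linear.has_derivative[OF bounded_linear_inner_left C1_on_D[OF C1_mapD[OF \<psi> c(1)] c(2)]], of v]
    by (simp add: inner_commute)
  \<comment> \<open>At a critical point of the height, \<open>v\<close> is itself a unit normal, so
    the normal direction \<open>J c u *\<^sub>R N (snd c u)\<close> is a multiple of
    \<open>v\<close>. As \<open>N\<close> is also orthogonal to \<open>v\<close> by the Stokes
    argument, \<open>N\<close> would be 0 there.\<close>
  have "J c u *\<^sub>R N (snd c u) = (v \<bullet> (J c u *\<^sub>R N (snd c u))) *\<^sub>R v"
    using cross_of_orthogonal_unit[OF v v_orth v_orth] cross_J[OF c] by metis
  moreover have "N (snd c u) \<bullet> v = 0" using zero[OF c] J_nz[OF c] by simp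
  ultimately have "N (snd c u) = 0" using J_nz[OF c] by (simp add: inner_commute)
  then show False using unit[OF c] by simp
qed

end

theorem theorem2p1:
  fixes v :: "real^3" and c :: real
  assumes "norm v = 1"
  shows "\<not> (\<exists>(X :: 'a topology) A \<psi> N.
    closed_oriented_surface X A \<and> translating_soliton c v X A \<psi> N)"
  using assms closed_surface.no_translating_soliton closed_surface.intro by blast

end
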